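(* Let $\mathbf t=(t_0,u_0,t_1,u_1)\in\mathbb C^4$ with $t_0,t_1\ne0$ and $t_0+t_1\notin-\frac12\mathbb N$. (a) The representation $\pi_{\mathbf t}:\mathbb C[\mathcal W]\to\mathrm{End}(\mathcal A)$ is faithful. (b) Assume moreover $2t_0,2t_1\notin\mathbb Z$. The decomposition $\mathcal A=\bigoplus_{n\in\mathbb Z_{\ge0}}\mathcal A(n)$ is the multiplicity-free, irreducible decomposition of $\mathcal A$ as a $\mathbb C[\mathcal W]$-module (via $\pi_{\mathbf t}$). Moreover, for every even polynomial $p\in\mathbb C[x^2]$, the element $p(\xi)$ of the center $\mathcal A_\xi^W$ of $\mathbb C[\mathcal W]$ acts on $\mathcal A(n)$ as multiplication by $p(\gamma_{2n})$.
   Context: $\mathbb N=\{1,2,\dots\}$; $\mathcal A=\mathbb C[x]$. $\mathcal W$ is the group generated by $s_0,s_1$ with relations $s_0^2=s_1^2=1$, $\mathbb C[\mathcal W]$ its group algebra, $\sigma_i=t_is_i$, $\xi=\sigma_0+\sigma_1\in\mathbb C[\mathcal W]$, and $\mathcal A_\xi^W=\{p(\xi): p\in\mathbb C[x^2]\}$, which is the center of $\mathbb C[\mathcal W]$. Operators on $\mathcal A$: $$(T_0f)(x)=t_0f(x)+\frac{(t_0+u_0+\frac12-x)(t_0-u_0+\frac12-x)}{1-2x}\big(f(1-x)-f(x)\big),$$ $$(T_1f)(x)=t_1f(x)+\frac{(t_1+u_1+x)(t_1-u_1+x)}{2x}\big(f(-x)-f(x)\big),$$ and $Y=T_0+T_1$;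 they preserve $\mathcal A$. $\pi_{\mathbf t}$ is the algebra homomorphism $\mathbb C[\mathcal W]\to\mathrm{End}(\mathcal A)$ determined by $\sigma_i\mapsto T_i$ ($i=0,1$). Put $\gamma_{2n}=t_0+t_1+n$ for $n\ge0$ and $\gamma_{2n-1}=-(t_0+t_1+n)$ for $n\ge1$ (pairwise distinct). The non-symmetric Wilson polynomial $p_m$ ($m\in\mathbb Z_{\ge0}$) is the unique monic polynomial of degree $m$ with $Yp_m=\gamma_mp_m$. Set $\mathcal A(0)=\mathrm{span}\{p_0\}$ and $\mathcal A(n)=\mathrm{span}\{p_{2n},p_{2n-1}\}$ for $n\in\mathbb N$. *)

theory Defs
  imports Complex_Main "HOL-Library.Poly_Mapping" "HOL-Computational_Algebra.Polynomial"
begin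

section \<open>The group \<open>\<W>\<close> and its group algebra\<close>

text \<open>
  \<open>\<W>\<close> is the set of words in \<open>s\<^sub>0, s\<^sub>1\<close> modulo the equivalence relation generated by deleting a
  factor \<open>s\<^sub>i s\<^sub>i\<close>.  Formal inverse letters are not needed, since the relations make each
  generator its own inverse; the universal property of the presentation is
  \<open>wgrp_universal_property\<close> below.

  The group is written additively, because the library's convolution product on finitely supported
  functions \<open>'g \<Rightarrow>\<^sub>0 'r\<close> is indexed by the class \<open>monoid_add\<close>.  That class and \<open>group_add\<close> do not
  assume commutativity, so \<open>s\<^sub>0 s\<^sub>1\<close> is \<open>ws\<^sub>0 + ws\<^sub>1\<close> and \<open>\<complex>[\<W>]\<close> is \<open>wgrp \<Rightarrow>\<^sub>0 complex\<close>.
\<close>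

datatype gen = S0 | S1

inductive cancel_step :: "gen list \<Rightarrow> gen list \<Rightarrow> bool" where
  "cancel_step (u @ [i, i] @ v) (u @ v)"

quotient_type wgrp = "gen list" / "equivclp cancel_step"
  by (rule equivp_evquivclp)

lemma cancel_step_context: "cancel_step a b \<Longrightarrow> cancel_step (u @ a @ v) (u @ b @ v)"
proof (induction rule: cancel_step.induct)
  case (1 x i y)
  show ?case using cancel_step.intros[of "u @ x" i "y @ v"] by simp
qed

lemma equivclp_cancel_context:
  "equivclp cancel_step a b \<Longrightarrow> equivclp cancel_step (u @ a @ v) (u @ b @ v)"
proof (induction rule: equivclp_induct)
  case base
  show ?case by simp
next
  case (step y z)
  then show ?case
    by (meson cancel_step_context equivclp_sym equivclp_trans r_into_equivclp)
qed

lemma cancel_step_rev: "cancel_step a b \<Longrightarrow> cancel_step (rev a) (rev b)"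
proof (induction rule: cancel_step.induct)
  case (1 x i y)
  show ?case using cancel_step.intros[of "rev y" i "rev x"] by simp
qed

lemma equivclp_cancel_rev:
  "equivclp cancel_step a b \<Longrightarrow> equivclp cancel_step (rev a) (rev b)"
proof (induction rule: equivclp_induct)
  case base
  show ?case by simp
next
  case (step y z)
  then show ?case
    by (meson cancel_step_rev equivclp_sym equivclp_trans r_into_equivclp)
qed

lemma equivclp_cancel_rev_append: "equivclp cancel_step (rev a @ a) []"
proof (induction a)
  case Nil
  show ?case by simp
next
  case (Cons i a)
  have "cancel_step (rev (i # a) @ i # a) (rev a @ a)"
    using cancel_step.intros[of "rev a" i a] by simp
  then show ?case using Cons by (meson equivclp_trans r_into_equivclp)
qed

instantiation wgrp :: group_add
begin

lift_definition zero_wgrp :: wgrp is "[]" .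

lift_definition plus_wgrp :: "wgrp \<Rightarrow> wgrp \<Rightarrow> wgrp" is "(@)"
proof -
  fix a b c d assume "equivclp cancel_step a b" "equivclp cancel_step c d"
  then show "equivclp cancel_step (a @ c) (b @ d)"
    using equivclp_cancel_context[of a b "[]" c] equivclp_cancel_context[of c d b "[]"]
    by (simp, meson equivclp_trans)
qed

lift_definition uminus_wgrp :: "wgrp \<Rightarrow> wgrp" is rev
  by (rule equivclp_cancel_rev)

definition minus_wgrp :: "wgrp \<Rightarrow> wgrp \<Rightarrow> wgrp" where
  "minus_wgrp a b = a + - b"

instance
proof
  fix a b c :: wgrp
  show "a + b + c = a + (b + c)" by transfer simp
  show "0 + a = a" by transfer simp
  show "a + 0 = a" by transfer simp
  show "- a + a = 0" by transfer (rule equivclp_cancel_rev_append)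
  show "a + - b = a - b" by (simp add: minus_wgrp_def)
qed

end

lift_definition wgen :: "gen \<Rightarrow> wgrp" is "\<lambda>i. [i]" .

abbreviation ws0 :: wgrp where "ws0 \<equiv> wgen S0"
abbreviation ws1 :: wgrp where "ws1 \<equiv> wgen S1"

lemma wgen_involution: "wgen i + wgen i = 0"
proof transfer
  fix i
  show "equivclp cancel_step ([i] @ [i]) []"
    using cancel_step.intros[of "[]" i "[]"] by (auto intro: r_into_equivclp)
qed

lemma wgrp_induct [case_names zero gen]:
  assumes "P 0" and "\<And>i w. P w \<Longrightarrow> P (wgen i + w)"
  shows "P w"
proof -
  have "P (abs_wgrp xs)" for xs
  proof (induction xs)
    case Nil
    show ?case using assms(1) by (simp add: zero_wgrp_def)
  next
    case (Cons i xs)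
    then show ?case using assms(2)[of "abs_wgrp xs" i] by (simp add: wgen.abs_eq plus_wgrp.abs_eq)
  qed
  then show ?thesis by (induction w rule: wgrp.abs_induct)
qed

text \<open>A monoid version of the universal property, applied below also to endomorphisms of \<open>\<A>\<close>.\<close>

lemma wgrp_monoid_hom_exists:
  fixes m :: "'m \<Rightarrow> 'm \<Rightarrow> 'm"
  assumes assoc: "\<And>x y z. m (m x y) z = m x (m y z)"
    and unit: "\<And>x. m e x = x" "\<And>x. m x e = x"
    and inv: "\<And>i. m (g i) (g i) = e"
  shows "\<exists>\<phi>. \<phi> 0 = e \<and> (\<forall>i. \<phi> (wgen i) = g i) \<and> (\<forall>x y. \<phi> (x + y) = m (\<phi> x) (\<phi> y))"
proof -
  define ev where "ev w = foldr (\<lambda>i. m (g i)) w e" for w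
  have app: "ev (u @ v) = m (ev u) (ev v)" for u v
    by (induction u) (auto simp: ev_def assoc unit)
  have two: "ev [i, i] = e" for i by (simp add: ev_def unit inv)
  have step: "ev a = ev b" if "cancel_step a b" for a b
    using that by cases (simp only: app two unit)
  have resp: "ev a = ev b" if "equivclp cancel_step a b" for a b
    using that by (induction rule: equivclp_induct) (auto dest: step)
  define \<phi> where "\<phi> x = ev (rep_wgrp x)" for x
  have phi: "\<phi> (abs_wgrp w) = ev w" for w
    unfolding \<phi>_def
    by (rule resp) (metis Quotient3_wgrp Quotient3_def wgrp.abs_eq_iff)
  have "\<phi> 0 = e" by (simp add: zero_wgrp_def phi ev_def)
  moreover have "\<phi> (wgen i) = g i" for i by (simp add: wgen.abs_eq phi ev_def unit)
  moreover have "\<phi> (x + y) = m (\<phi> x) (\<phi> y)" for x y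
    by (induction x rule: wgrp.abs_induct, induction y rule: wgrp.abs_induct)
      (simp add: plus_wgrp.abs_eq phi app)
  ultimately show ?thesis by blast
qed

theorem wgrp_universal_property:
  fixes g0 g1 :: "'g::group_add"
  assumes "g0 + g0 = 0" "g1 + g1 = 0"
  shows "\<exists>!\<phi> :: wgrp \<Rightarrow> 'g. (\<forall>x y. \<phi> (x + y) = \<phi> x + \<phi> y) \<and> \<phi> ws0 = g0 \<and> \<phi> ws1 = g1"
proof -
  obtain \<phi> :: "wgrp \<Rightarrow> 'g" where phi: "\<forall>x y. \<phi> (x + y) = \<phi> x + \<phi> y"
      "\<forall>i. \<phi> (wgen i) = (case i of S0 \<Rightarrow> g0 | S1 \<Rightarrow> g1)"
  proof -
    have "(case i of S0 \<Rightarrow> g0 | S1 \<Rightarrow> g1) + (case i of S0 \<Rightarrow> g0 | S1 \<Rightarrow> g1) = 0" for i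
      using assms by (cases i) simp_all
    then show ?thesis
      using wgrp_monoid_hom_exists[of "(+)" "0 :: 'g" "\<lambda>i. case i of S0 \<Rightarrow> g0 | S1 \<Rightarrow> g1"] that
      by (auto simp: add.assoc)
  qed
  have uniq: "\<psi> = \<phi>" if psi: "\<forall>x y. \<psi> (x + y) = \<psi> x + \<psi> y" "\<psi> ws0 = g0" "\<psi> ws1 = g1" for \<psi>
  proof
    fix w show "\<psi> w = \<phi> w"
    proof (induction w rule: wgrp_induct)
      case zero
      have "\<psi> 0 = 0" "\<phi> 0 = 0"
        using psi(1)[rule_format, of 0 0] phi(1)[rule_format, of 0 0]
        by (metis add.right_neutral add_left_cancel)+
      then show ?case by simp
    next
      case (gen i w)
      then show ?case using psi phi by (cases i) simp_all
    qed
  qed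
  show ?thesis
  proof (rule ex1I[of _ \<phi>])
    show "(\<forall>x y. \<phi> (x + y) = \<phi> x + \<phi> y) \<and> \<phi> ws0 = g0 \<and> \<phi> ws1 = g1"
      by (intro conjI phi(1)) (simp_all only: phi(2)[rule_format] gen.case)
  next
    fix \<psi> :: "wgrp \<Rightarrow> 'g"
    assume "(\<forall>x y. \<psi> (x + y) = \<psi> x + \<psi> y) \<and> \<psi> ws0 = g0 \<and> \<psi> ws1 = g1"
    then show "\<psi> = \<phi>" by (elim conjE) (rule uniq)
  qed
qed

type_synonym walg = "wgrp \<Rightarrow>\<^sub>0 complex"

definition walg_scale :: "complex \<Rightarrow> walg \<Rightarrow> walg" where
  "walg_scale c a = Poly_Mapping.single 0 c * a"

definition sigma0 :: "complex \<Rightarrow> walg" where "sigma0 t0 = Poly_Mapping.single ws0 t0"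
definition sigma1 :: "complex \<Rightarrow> walg" where "sigma1 t1 = Poly_Mapping.single ws1 t1"

definition xi :: "complex \<Rightarrow> complex \<Rightarrow> walg" where "xi t0 t1 = sigma0 t0 + sigma1 t1"

definition walg_center :: "walg set" where
  "walg_center = {z. \<forall>a. z * a = a * z}"

text \<open>The library's \<open>poly\<close> evaluates only in commutative rings.\<close>

definition walg_eval :: "complex poly \<Rightarrow> walg \<Rightarrow> walg" where
  "walg_eval p a = (\<Sum>k\<le>degree p. walg_scale (coeff p k) (a ^ k))"

definition even_polys :: "complex poly set" where
  "even_polys = range (\<lambda>q. pcompose q (monom 1 2))"


section \<open>The operators on \<open>\<A> = \<complex>[x]\<close>\<close>

interpretation cpoly: vector_space "smult :: complex \<Rightarrow> complex poly \<Rightarrow> complex poly"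
  by unfold_locales (simp_all add: smult_add_right smult_add_left)

text \<open>
  The divisions by \<open>1 - 2x\<close> and \<open>2x\<close> are exact, so \<open>div\<close> on polynomials gives the operators of the
  rational formulas (lemmas \<open>poly_opT0\<close> and \<open>poly_opT1\<close>).
\<close>

definition opT0 :: "complex \<Rightarrow> complex \<Rightarrow> complex poly \<Rightarrow> complex poly" where
  "opT0 t0 u0 f = smult t0 f +
     ([:t0 + u0 + 1/2, -1:] * [:t0 - u0 + 1/2, -1:] * (pcompose f [:1, -1:] - f)) div [:1, -2:]"

definition opT1 :: "complex \<Rightarrow> complex \<Rightarrow> complex poly \<Rightarrow> complex poly" where
  "opT1 t1 u1 f = smult t1 f +
     ([:t1 + u1, 1:] * [:t1 - u1, 1:] * (pcompose f [:0, -1:] - f)) div [:0, 2:]"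

definition opY :: "complex \<Rightarrow> complex \<Rightarrow> complex \<Rightarrow> complex \<Rightarrow> complex poly \<Rightarrow> complex poly" where
  "opY t0 u0 t1 u1 f = opT0 t0 u0 f + opT1 t1 u1 f"

lemma linear_factor_dvd:
  fixes q :: "complex poly"
  assumes "b \<noteq> 0" "poly q (- a / b) = 0"
  shows "[:a, b:] dvd q"
proof -
  have "[:a, b:] = smult b [:- (- a / b), 1:]" using assms by simp
  moreover have "[:- (- a / b), 1:] dvd q" using assms by (simp only: poly_eq_0_iff_dvd)
  ultimately show ?thesis using assms by (metis smult_dvd)
qed

lemma poly_div_exact:
  fixes p d :: "complex poly"
  assumes "d dvd p" "poly d x \<noteq> 0"
  shows "poly (p div d) x = poly p x / poly d x"
  using assms by (metis dvd_div_mult_self nonzero_mult_div_cancel_right poly_mult)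

lemma not_half: "x \<noteq> 1/2 \<Longrightarrow> 1 - 2 * x \<noteq> (0 :: complex)"
proof
  assume x: "x \<noteq> 1/2" and "1 - 2 * x = 0"
  have "x = (1 - (1 - 2 * x)) / 2" by simp
  also have "\<dots> = 1/2" by (simp only: \<open>1 - 2 * x = 0\<close>) simp
  finally show False using x by blast
qed

lemma poly_opT0:
  assumes "x \<noteq> 1/2"
  shows "poly (opT0 t0 u0 f) x = t0 * poly f x +
    (t0 + u0 + 1/2 - x) * (t0 - u0 + 1/2 - x) / (1 - 2 * x) * (poly f (1 - x) - poly f x)"
proof -
  have "[:1, -2:] dvd pcompose f [:1, -1:] - f"
    by (rule linear_factor_dvd) (simp_all add: poly_pcompose)
  then have "[:1, -2:] dvd [:t0 + u0 + 1/2, -1:] * [:t0 - u0 + 1/2, -1:] * (pcompose f [:1, -1:] - f)"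
    by (rule dvd_mult)
  moreover have "poly [:1, -2:] x \<noteq> 0" using not_half[OF assms] by (simp add: mult.commute)
  ultimately show ?thesis
    by (simp add: opT0_def poly_div_exact poly_pcompose mult.commute del: mult_pCons_left mult_pCons_right)
qed

lemma poly_opT1:
  assumes "x \<noteq> 0"
  shows "poly (opT1 t1 u1 f) x = t1 * poly f x +
    (t1 + u1 + x) * (t1 - u1 + x) / (2 * x) * (poly f (- x) - poly f x)"
proof -
  have "[:0, 2:] dvd pcompose f [:0, -1:] - f"
    by (rule linear_factor_dvd) (simp_all add: poly_pcompose)
  then have "[:0, 2:] dvd [:t1 + u1, 1:] * [:t1 - u1, 1:] * (pcompose f [:0, -1:] - f)"
    by (rule dvd_mult)
  moreover have "poly [:0, 2:] x \<noteq> 0" using assms by simp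
  ultimately show ?thesis
    by (simp add: opT1_def poly_div_exact poly_pcompose mult.commute del: mult_pCons_left mult_pCons_right)
qed

lemma poly_eq_off_point:
  fixes p q :: "complex poly"
  assumes "\<And>x. x \<noteq> a \<Longrightarrow> poly p x = poly q x"
  shows "p = q"
proof -
  have "poly (p - q) x = 0 \<or> x = a" for x using assms by auto
  then have "poly ((p - q) * [:- a, 1:]) = poly 0" by (auto simp: fun_eq_iff simp del: mult_pCons_right)
  then have "(p - q) * [:- a, 1:] = 0" by (simp only: poly_eq_poly_eq_iff)
  then show ?thesis by (metis mult_eq_0_iff pCons_eq_0_iff right_minus_eq zero_neq_one)
qed

lemma opT0_linear: "Vector_Spaces.linear smult smult (opT0 t0 u0)"
proof -
  have "opT0 t0 u0 (f + g) = opT0 t0 u0 f + opT0 t0 u0 g" for f g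
    by (rule poly_eq_off_point[of "1/2"])
      (simp add: poly_opT0 right_diff_distrib distrib_left del: times_divide_eq_left)
  moreover have "opT0 t0 u0 (smult c f) = smult c (opT0 t0 u0 f)" for c f
    by (rule poly_eq_off_point[of "1/2"])
      (simp add: poly_opT0 right_diff_distrib distrib_left mult.left_commute[of _ c] del: times_divide_eq_left)
  ultimately show ?thesis by (simp add: Vector_Spaces.linear_iff cpoly.vector_space_axioms)
qed

lemma opT1_linear: "Vector_Spaces.linear smult smult (opT1 t1 u1)"
proof -
  have "opT1 t1 u1 (f + g) = opT1 t1 u1 f + opT1 t1 u1 g" for f g
    by (rule poly_eq_off_point[of 0])
      (simp add: poly_opT1 right_diff_distrib distrib_left del: times_divide_eq_left)
  moreover have "opT1 t1 u1 (smult c f) = smult c (opT1 t1 u1 f)" for c f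
    by (rule poly_eq_off_point[of 0])
      (simp add: poly_opT1 right_diff_distrib distrib_left mult.left_commute[of _ c] del: times_divide_eq_left)
  ultimately show ?thesis by (simp add: Vector_Spaces.linear_iff cpoly.vector_space_axioms)
qed

lemma hecke_identity:
  fixes A B F G t :: complex
  assumes "A + B = 2 * t"
  shows "t * (t * F + A * (G - F)) + A * ((t * G + B * (F - G)) - (t * F + A * (G - F))) = t\<^sup>2 * F"
proof -
  have B: "B = 2 * t - A" using assms by (simp add: algebra_simps)
  show ?thesis unfolding B by (simp add: algebra_simps power2_eq_square)
qed

lemma opT0_square: "opT0 t0 u0 (opT0 t0 u0 f) = smult (t0\<^sup>2) f"
proof (rule poly_eq_off_point[of "1/2"])
  fix x :: complex assume h: "x \<noteq> 1/2"
  have h': "1 - x \<noteq> 1/2"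
  proof
    assume "1 - x = 1/2"
    then have "x = 1 - 1/2" by (metis diff_diff_eq2 add_diff_cancel_left')
    then show False using h by simp
  qed
  have x: "1 - 2 * x \<noteq> 0" using h by (rule not_half)
  define A where "A = (t0 + u0 + 1/2 - x) * (t0 - u0 + 1/2 - x) / (1 - 2 * x)"
  define B where "B = (t0 + u0 + 1/2 - (1 - x)) * (t0 - u0 + 1/2 - (1 - x)) / (1 - 2 * (1 - x))"
  have "B = - ((t0 + u0 + 1/2 - (1 - x)) * (t0 - u0 + 1/2 - (1 - x)) / (1 - 2 * x))"
  proof -
    have "1 - 2 * (1 - x) = - (1 - 2 * x)" by simp
    then show ?thesis unfolding B_def by (metis divide_minus_right)
  qed
  then have "A + B = 2 * t0" unfolding A_def using x by (simp add: field_simps)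
  from hecke_identity[OF this, of "poly f x" "poly f (1 - x)"]
  show "poly (opT0 t0 u0 (opT0 t0 u0 f)) x = poly (smult (t0\<^sup>2) f) x"
    unfolding poly_opT0[OF h] poly_opT0[OF h'] A_def B_def by simp
qed

lemma opT1_square: "opT1 t1 u1 (opT1 t1 u1 f) = smult (t1\<^sup>2) f"
proof (rule poly_eq_off_point[of 0])
  fix x :: complex assume x: "x \<noteq> 0"
  then have x': "- x \<noteq> 0" by simp
  define A where "A = (t1 + u1 + x) * (t1 - u1 + x) / (2 * x)"
  define B where "B = (t1 + u1 + - x) * (t1 - u1 + - x) / (2 * - x)"
  have "A + B = 2 * t1" unfolding A_def B_def using x by (simp add: field_simps)
  from hecke_identity[OF this, of "poly f x" "poly f (- x)"]
  show "poly (opT1 t1 u1 (opT1 t1 u1 f)) x = poly (smult (t1\<^sup>2) f) x"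
    unfolding poly_opT1[OF x] poly_opT1[OF x'] A_def B_def by simp
qed


section \<open>Representations of \<open>\<complex>[\<W>]\<close> on \<open>\<A>\<close>\<close>

text \<open>Unital algebra homomorphisms from \<open>\<complex>[\<W>]\<close> to the \<open>\<complex>\<close>-linear endomorphisms of \<open>\<A>\<close>.\<close>

definition walg_rep :: "(walg \<Rightarrow> complex poly \<Rightarrow> complex poly) \<Rightarrow> bool" where
  "walg_rep \<rho> \<longleftrightarrow>
     (\<forall>a. Vector_Spaces.linear smult smult (\<rho> a)) \<and>
     (\<forall>a b f. \<rho> (a + b) f = \<rho> a f + \<rho> b f) \<and>
     (\<forall>c a f. \<rho> (walg_scale c a) f = smult c (\<rho> a f)) \<and>
     (\<forall>a b. \<rho> (a * b) = \<rho> a \<circ> \<rho> b) \<and>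
     \<rho> 1 = id"

definition faithful_rep :: "(walg \<Rightarrow> complex poly \<Rightarrow> complex poly) \<Rightarrow> bool" where
  "faithful_rep \<rho> \<longleftrightarrow> walg_rep \<rho> \<and> inj \<rho>"

definition submodule :: "(walg \<Rightarrow> complex poly \<Rightarrow> complex poly) \<Rightarrow> complex poly set \<Rightarrow> bool" where
  "submodule \<rho> V \<longleftrightarrow> cpoly.subspace V \<and> (\<forall>a. \<forall>f\<in>V. \<rho> a f \<in> V)"

definition irreducible_submodule ::
    "(walg \<Rightarrow> complex poly \<Rightarrow> complex poly) \<Rightarrow> complex poly set \<Rightarrow> bool" where
  "irreducible_submodule \<rho> V \<longleftrightarrow>
     submodule \<rho> V \<and> V \<noteq> {0} \<and> (\<forall>U. submodule \<rho> U \<longrightarrow> U \<subseteq> V \<longrightarrow> U = {0} \<or> U = V)"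

definition isomorphic_submodules ::
    "(walg \<Rightarrow> complex poly \<Rightarrow> complex poly) \<Rightarrow> complex poly set \<Rightarrow> complex poly set \<Rightarrow> bool" where
  "isomorphic_submodules \<rho> V U \<longleftrightarrow>
     (\<exists>\<phi>. bij_betw \<phi> V U \<and>
        (\<forall>f\<in>V. \<forall>g\<in>V. \<phi> (f + g) = \<phi> f + \<phi> g) \<and>
        (\<forall>c. \<forall>f\<in>V. \<phi> (smult c f) = smult c (\<phi> f)) \<and>
        (\<forall>a. \<forall>f\<in>V. \<phi> (\<rho> a f) = \<rho> a (\<phi> f)))"

definition direct_sum_decomposition :: "(nat \<Rightarrow> complex poly set) \<Rightarrow> bool" where
  "direct_sum_decomposition V \<longleftrightarrow>
     (\<forall>n. cpoly.subspace (V n)) \<and>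
     (\<forall>f. \<exists>!g. (\<forall>n. g n \<in> V n) \<and> finite {n. g n \<noteq> 0} \<and> f = (\<Sum>n | g n \<noteq> 0. g n))"

definition mult_free_irred_decomposition ::
    "(walg \<Rightarrow> complex poly \<Rightarrow> complex poly) \<Rightarrow> (nat \<Rightarrow> complex poly set) \<Rightarrow> bool" where
  "mult_free_irred_decomposition \<rho> V \<longleftrightarrow>
     direct_sum_decomposition V \<and>
     (\<forall>n. irreducible_submodule \<rho> (V n)) \<and>
     (\<forall>m n. m \<noteq> n \<longrightarrow> \<not> isomorphic_submodules \<rho> (V m) (V n))"

text \<open>Existence and uniqueness for \<open>t\<^sub>0, t\<^sub>1 \<noteq> 0\<close> is lemma \<open>pi_rep_ex1\<close>.\<close>

definition pi_rep ::
    "complex \<Rightarrow> complex \<Rightarrow> complex \<Rightarrow> complex \<Rightarrow> walg \<Rightarrow> complex poly \<Rightarrow> complex poly" where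
  "pi_rep t0 u0 t1 u1 =
     (THE \<rho>. walg_rep \<rho> \<and> \<rho> (sigma0 t0) = opT0 t0 u0 \<and> \<rho> (sigma1 t1) = opT1 t1 u1)"

lemma walg_scale_single: "walg_scale c (Poly_Mapping.single w d) = Poly_Mapping.single w (c * d)"
  by (simp add: walg_scale_def mult_single)

lemma walg_sum_single:
  fixes a :: walg
  shows
  "a = (\<Sum>w\<in>Poly_Mapping.keys a. Poly_Mapping.single w (Poly_Mapping.lookup a w))"
proof (rule poly_mapping_eqI)
  fix k
  show "Poly_Mapping.lookup a k = Poly_Mapping.lookup
      (\<Sum>w\<in>Poly_Mapping.keys a. Poly_Mapping.single w (Poly_Mapping.lookup a w)) k"
    by (simp add: lookup_sum lookup_single when_def in_keys_iff)
qed

lemma walg_induct [case_names zero single add]: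
  fixes a :: walg
  assumes "P 0" "\<And>w c. P (Poly_Mapping.single w c)" "\<And>a b. P a \<Longrightarrow> P b \<Longrightarrow> P (a + b)"
  shows "P a"
proof -
  have "P (\<Sum>w\<in>S. Poly_Mapping.single w (h w))" for S h
    by (induction S rule: infinite_finite_induct) (auto intro: assms)
  then show ?thesis using walg_sum_single[of a] by metis
qed

lemma walg_rep_extends:
  assumes lin: "\<And>w. Vector_Spaces.linear smult smult (\<phi> w)"
    and one: "\<phi> 0 = id" and mult: "\<And>v w. \<phi> (v + w) = \<phi> v \<circ> \<phi> w"
  shows "\<exists>\<rho>. walg_rep \<rho> \<and> (\<forall>w c f. \<rho> (Poly_Mapping.single w c) f = smult c (\<phi> w f))"
proof -
  have phi_add: "\<phi> w (f + g) = \<phi> w f + \<phi> w g" and phi_smult: "\<phi> w (smult c f) = smult c (\<phi> w f)"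
    for w f g c
    using lin[of w] by (auto simp: Vector_Spaces.linear_iff)
  define \<rho> where
    "\<rho> a f = (\<Sum>w\<in>Poly_Mapping.keys a. smult (Poly_Mapping.lookup a w) (\<phi> w f))" for a f
  have sup: "\<rho> a f = (\<Sum>w\<in>S. smult (Poly_Mapping.lookup a w) (\<phi> w f))"
    if "finite S" "Poly_Mapping.keys a \<subseteq> S" for a f S
    unfolding \<rho>_def by (rule sum.mono_neutral_left) (use that in \<open>auto simp: in_keys_iff\<close>)
  have rs: "\<rho> (Poly_Mapping.single w c) f = smult c (\<phi> w f)" for w c f
    using sup[of "{w}" "Poly_Mapping.single w c" f] by simp
  have rz: "\<rho> 0 f = 0" for f by (simp add: \<rho>_def)
  have ra: "\<rho> (a + b) f = \<rho> a f + \<rho> b f" for a b f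
  proof -
    let ?S = "Poly_Mapping.keys a \<union> Poly_Mapping.keys b"
    have "Poly_Mapping.keys (a + b) \<subseteq> ?S" by (rule keys_add)
    then show ?thesis
      by (simp add: sup[of ?S] lookup_add smult_add_left sum.distrib)
  qed
  have rho_add: "\<rho> a (f + g) = \<rho> a f + \<rho> a g" for a f g
    by (simp add: \<rho>_def phi_add smult_add_right sum.distrib)
  have rho_smult: "\<rho> a (smult c f) = smult c (\<rho> a f)" for a c f
    by (induction a rule: walg_induct)
      (simp_all add: rz rs ra phi_smult smult_add_right mult.commute)
  have rho_zero: "\<rho> a 0 = 0" for a using rho_smult[of a 0 0] by simp
  have single_mult: "\<rho> (Poly_Mapping.single w c * b) f = smult c (\<phi> w (\<rho> b f))" for w c b f
  proof (induction b rule: walg_induct)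
    case zero
    have "\<phi> w 0 = 0" using phi_smult[of w 0 0] by simp
    then show ?case by (simp add: rz)
  next
    case (single v d)
    then show ?case by (simp add: mult_single rs mult phi_smult)
  next
    case (add a b)
    then show ?case by (simp add: ra distrib_left phi_add smult_add_right)
  qed
  have rho_mult: "\<rho> (a * b) f = \<rho> a (\<rho> b f)" for a b f
    by (induction a rule: walg_induct) (simp_all add: rz rs ra single_mult distrib_right)
  have "walg_rep \<rho>"
    unfolding walg_rep_def
  proof (intro conjI allI)
    show "Vector_Spaces.linear smult smult (\<rho> a)" for a
      by (simp add: Vector_Spaces.linear_iff cpoly.vector_space_axioms rho_add rho_smult)
    show "\<rho> (a + b) f = \<rho> a f + \<rho> b f" for a b f by (rule ra)
    show "\<rho> (walg_scale c a) f = smult c (\<rho> a f)" for c a f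
      by (simp add: walg_scale_def single_mult one)
    show "\<rho> (a * b) = \<rho> a \<circ> \<rho> b" for a b by (simp add: fun_eq_iff rho_mult)
    show "\<rho> 1 = id"
      using rs[of 0 1] by (simp add: fun_eq_iff one)
  qed
  then show ?thesis using rs by blast
qed

lemma pi_rep_ex1:
  assumes t0: "t0 \<noteq> 0" and t1: "t1 \<noteq> 0"
  shows "\<exists>!\<rho>. walg_rep \<rho> \<and> \<rho> (sigma0 t0) = opT0 t0 u0 \<and> \<rho> (sigma1 t1) = opT1 t1 u1"
proof -
  define g where "g i = (case i of
      S0 \<Rightarrow> (\<lambda>f. smult (1 / t0) (opT0 t0 u0 f)) | S1 \<Rightarrow> (\<lambda>f. smult (1 / t1) (opT1 t1 u1 f)))" for i
  have T0_smult: "opT0 t0 u0 (smult c f) = smult c (opT0 t0 u0 f)" for c f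
    using opT0_linear by (simp add: Vector_Spaces.linear_iff)
  have T1_smult: "opT1 t1 u1 (smult c f) = smult c (opT1 t1 u1 f)" for c f
    using opT1_linear by (simp add: Vector_Spaces.linear_iff)
  have g_square: "g i \<circ> g i = id" for i
    using t0 t1
    by (cases i) (simp_all add: g_def fun_eq_iff T0_smult T1_smult opT0_square opT1_square power2_eq_square)
  have g_linear: "Vector_Spaces.linear smult smult (g i)" for i
    using opT0_linear[of t0 u0] opT1_linear[of t1 u1]
    by (cases i) (simp_all add: g_def Vector_Spaces.linear_iff smult_add_right mult.commute)
  obtain \<phi> where phi: "\<phi> 0 = id" "\<And>i. \<phi> (wgen i) = g i" "\<And>v w. \<phi> (v + w) = \<phi> v \<circ> \<phi> w"
    using wgrp_monoid_hom_exists[of "(\<circ>)" id g] g_square by (auto simp: o_assoc)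
  have phi_linear: "Vector_Spaces.linear smult smult (\<phi> w)" for w
  proof (induction w rule: wgrp_induct)
    case zero
    show ?case unfolding phi(1) by (simp add: Vector_Spaces.linear_iff cpoly.vector_space_axioms)
  next
    case (gen i w)
    then show ?case using g_linear[of i] by (simp add: phi Vector_Spaces.linear_iff)
  qed
  obtain \<rho> where rho: "walg_rep \<rho>"
      "\<And>w c f. \<rho> (Poly_Mapping.single w c) f = smult c (\<phi> w f)"
    using walg_rep_extends[of \<phi>, OF phi_linear phi(1) phi(3)] by blast
  have rho_T: "\<rho> (sigma0 t0) = opT0 t0 u0" "\<rho> (sigma1 t1) = opT1 t1 u1"
    using t0 t1 by (auto simp: fun_eq_iff sigma0_def sigma1_def rho(2) phi(2) g_def)
  have uniq: "\<rho>' = \<rho>"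
    if rep: "walg_rep \<rho>'" and T: "\<rho>' (sigma0 t0) = opT0 t0 u0" "\<rho>' (sigma1 t1) = opT1 t1 u1" for \<rho>'
  proof -
    have add: "\<rho>' (a + b) f = \<rho>' a f + \<rho>' b f" and scale: "\<rho>' (walg_scale c a) f = smult c (\<rho>' a f)"
      and mult: "\<rho>' (a * b) = \<rho>' a \<circ> \<rho>' b" and one: "\<rho>' 1 = id" for a b c f
      using rep by (simp_all add: walg_rep_def)
    have zero_rep: "\<rho>' 0 f = 0" for f using add[of 0 0 f] by simp
    have gen: "\<rho>' (Poly_Mapping.single (wgen i) 1) = g i" for i
    proof (cases i)
      case S0
      have "Poly_Mapping.single ws0 1 = walg_scale (1 / t0) (sigma0 t0)"
        using t0 by (simp add: sigma0_def walg_scale_single)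
      then show ?thesis by (simp add: S0 g_def fun_eq_iff scale T)
    next
      case S1
      have "Poly_Mapping.single ws1 1 = walg_scale (1 / t1) (sigma1 t1)"
        using t1 by (simp add: sigma1_def walg_scale_single)
      then show ?thesis by (simp add: S1 g_def fun_eq_iff scale T)
    qed
    have word: "\<rho>' (Poly_Mapping.single w 1) = \<phi> w" for w
    proof (induction w rule: wgrp_induct)
      case zero
      show ?case using one by (simp add: phi)
    next
      case (gen i w)
      have "Poly_Mapping.single (wgen i + w) (1::complex) =
          Poly_Mapping.single (wgen i) 1 * Poly_Mapping.single w 1"
        by (simp add: mult_single)
      then show ?case
        using gen \<open>\<And>i. \<rho>' (Poly_Mapping.single (wgen i) 1) = g i\<close> by (simp add: mult phi)
    qed
    have "\<rho>' a f = \<rho> a f" for a f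
    proof (induction a rule: walg_induct)
      case zero
      have "\<rho> 0 f = 0" using rho(2)[of 0 0 f] by simp
      then show ?case by (simp add: zero_rep)
    next
      case (single w c)
      have "Poly_Mapping.single w c = walg_scale c (Poly_Mapping.single w 1)"
        by (simp add: walg_scale_single)
      then show ?case using rho(2)[of w c f] by (simp add: scale word)
    next
      case (add a b)
      then show ?case using rho(1) \<open>\<And>a b f. \<rho>' (a + b) f = \<rho>' a f + \<rho>' b f\<close>
        by (simp add: walg_rep_def)
    qed
    then show ?thesis by (simp add: fun_eq_iff)
  qed
  show ?thesis
  proof (rule ex1I[of _ \<rho>])
    show "walg_rep \<rho> \<and> \<rho> (sigma0 t0) = opT0 t0 u0 \<and> \<rho> (sigma1 t1) = opT1 t1 u1"
      using rho(1) rho_T by (intro conjI)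
  next
    fix \<rho>'
    assume "walg_rep \<rho>' \<and> \<rho>' (sigma0 t0) = opT0 t0 u0 \<and> \<rho>' (sigma1 t1) = opT1 t1 u1"
    then show "\<rho>' = \<rho>" by (elim conjE) (rule uniq)
  qed
qed

lemmas pi_rep_properties = theI'[OF pi_rep_ex1, folded pi_rep_def]


section \<open>Non-symmetric Wilson polynomials\<close>

text \<open>\<open>\<gamma>\<^sub>2\<^sub>n = t\<^sub>0 + t\<^sub>1 + n\<close>, and \<open>\<gamma>\<^sub>2\<^sub>n\<^sub>-\<^sub>1 = -(t\<^sub>0 + t\<^sub>1 + n)\<close>, so that \<open>n = (m + 1) / 2\<close> for odd \<open>m\<close>.\<close>

definition wilson_gamma :: "complex \<Rightarrow> complex \<Rightarrow> nat \<Rightarrow> complex" where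
  "wilson_gamma t0 t1 m =
     (if even m then t0 + t1 + of_nat (m div 2) else - (t0 + t1 + of_nat ((m + 1) div 2)))"

definition wilson_poly :: "complex \<Rightarrow> complex \<Rightarrow> complex \<Rightarrow> complex \<Rightarrow> nat \<Rightarrow> complex poly" where
  "wilson_poly t0 u0 t1 u1 m =
     (THE p. degree p = m \<and> lead_coeff p = 1 \<and> opY t0 u0 t1 u1 p = smult (wilson_gamma t0 t1 m) p)"

definition wilson_space :: "complex \<Rightarrow> complex \<Rightarrow> complex \<Rightarrow> complex \<Rightarrow> nat \<Rightarrow> complex poly set" where
  "wilson_space t0 u0 t1 u1 n =
     (if n = 0 then cpoly.span {wilson_poly t0 u0 t1 u1 0}
      else cpoly.span {wilson_poly t0 u0 t1 u1 (2 * n), wilson_poly t0 u0 t1 u1 (2 * n - 1)})"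

end

theory Submission
  imports Defs
begin

text \<open>
  \<open>Y\<close> is triangular on monomials with distinct diagonal entries \<open>\<gamma>\<^sub>m\<close>, so it has the monic
  eigenbasis \<open>p\<^sub>m\<close>.  Since \<open>\<xi>\<^sup>2\<close> is central and the \<open>\<gamma>\<^sub>2\<^sub>n\<^sup>2\<close> are distinct, \<open>\<A>(n)\<close> is the
  \<open>\<gamma>\<^sub>2\<^sub>n\<^sup>2\<close>-eigenspace of \<open>Y\<^sup>2\<close>, hence a submodule, and distinct \<open>\<A>(n)\<close> are not isomorphic.
  A common eigenvector of \<open>T\<^sub>0\<close> and \<open>Y\<close> has \<open>Y\<close>-eigenvalue \<open>\<plusminus>t\<^sub>0 \<plusminus> t\<^sub>1\<close>.  Under the non-integrality
  conditions this is never \<open>\<gamma>\<^sub>m\<close> with \<open>m \<ge> 1\<close>, which gives irreducibility; without them it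
  still happens for at most four \<open>m\<close>.  Every element of the group algebra is
  \<open>q(\<xi>) + \<sigma>\<^sub>0 r(\<xi>)\<close>, and if it acts as zero on \<open>p\<^sub>m\<close> for any other \<open>m\<close> then \<open>q\<close> and \<open>r\<close> vanish at
  \<open>\<gamma>\<^sub>m\<close>, so \<open>q = r = 0\<close>.
\<close>

section \<open>Triangular operators on polynomials\<close>

text \<open>In the monomial basis \<open>L\<close> is upper triangular with pairwise distinct
  diagonal entries \<open>g m\<close>, so eigenvectors can be found by back substitution.\<close>

locale triangular_operator =
  Vector_Spaces.linear smult smult L for L :: "'a::field poly \<Rightarrow> 'a poly" +
  fixes g :: "nat \<Rightarrow> 'a"
  assumes coeff_monom_image: "k \<ge> m \<Longrightarrow> coeff (L (monom 1 m)) k = (if k = m then g m else 0)"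
    and inj_g: "inj g"
begin

lemma coeff_image:
  assumes "\<And>i. i > k \<Longrightarrow> coeff f i = 0"
  shows "coeff (L f) k = g k * coeff f k"
proof -
  have "degree f \<le> k" using assms by (intro degree_le) auto
  then have "f = (\<Sum>i\<le>k. smult (coeff f i) (monom 1 i))"
    by (simp add: smult_monom poly_as_sum_of_monoms')
  then have "L f = (\<Sum>i\<le>k. smult (coeff f i) (L (monom 1 i)))"
    by (metis (no_types, lifting) sum scale sum.cong)
  then have "coeff (L f) k = (\<Sum>i\<le>k. coeff f i * coeff (L (monom 1 i)) k)"
    by (simp add: coeff_sum)
  also have "\<dots> = (\<Sum>i\<le>k. if i = k then coeff f i * g i else 0)"
    by (intro sum.cong) (auto simp: coeff_monom_image)
  finally show ?thesis by simp
qed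

text \<open>Below degree \<open>m\<close>, \<open>L - g m\<close> is triangular with nonzero
  diagonal entries \<open>g k - g m\<close>, so the equation is solved from the top coefficient
  down. Bounding coefficients instead of the degree makes \<open>n = 0\<close> mean the zero
  polynomial.\<close>

lemma shifted_image_surj:
  assumes "n \<le> m" "\<And>k. k \<ge> n \<Longrightarrow> coeff f k = 0"
  shows "\<exists>h. (\<forall>k\<ge>n. coeff h k = 0) \<and> L h - smult (g m) h = f"
  using assms
proof (induction n arbitrary: f)
  case 0
  then have "f = 0" by (simp add: poly_eq_iff)
  then show ?case by (intro exI[of _ 0]) simp
next
  case (Suc n)
  define a where "a = monom (coeff f n / (g n - g m)) n"
  have "g n \<noteq> g m" using Suc.prems inj_g by (auto dest: injD)
  then have top: "coeff (f - (L a - smult (g m) a)) k = 0" if "k \<ge> n" for k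
    using that Suc.prems(2)[of k] by (cases "k = n") (auto simp: a_def coeff_image field_simps)
  obtain h where h: "\<forall>k\<ge>n. coeff h k = 0" "L h - smult (g m) h = f - (L a - smult (g m) a)"
    using Suc.IH[OF _ top] Suc.prems by auto
  then have "L (a + h) - smult (g m) (a + h) = f"
    by (simp add: add smult_add_right algebra_simps)
  moreover have "\<forall>k\<ge>Suc n. coeff (a + h) k = 0" using h(1) by (simp add: a_def)
  ultimately show ?case by blast
qed

text \<open>Existence: the defect of \<open>monom 1 m\<close> vanishes from degree \<open>m\<close>
  on and is removed by a lower correction \<open>h\<close>. Uniqueness: the difference of two
  solutions is an eigenvector without a term of degree \<open>m\<close>, but the eigenvalue
  determines the degree.\<close>

lemma monic_eigenpoly_ex1:
  "\<exists>!p. degree p = m \<and> lead_coeff p = 1 \<and> L p = smult (g m) p"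
proof -
  have top: "coeff (L (monom 1 m) - smult (g m) (monom 1 m)) k = 0" if "k \<ge> m" for k
    using that by (auto simp: coeff_monom_image)
  obtain h where h: "\<forall>k\<ge>m. coeff h k = 0"
      "L h - smult (g m) h = L (monom 1 m) - smult (g m) (monom 1 m)"
    using shifted_image_surj[OF order_refl top] by blast
  define p where "p = monom 1 m - h"
  have "coeff p m = 1" "\<And>k. k > m \<Longrightarrow> coeff p k = 0" using h(1) by (auto simp: p_def)
  then have deg: "degree p = m" by (intro antisym degree_le le_degree) auto
  have Lp: "L p = smult (g m) p"
    using h(2) by (simp add: p_def diff smult_diff_right algebra_simps)
  show ?thesis
  proof (rule ex1I[of _ p])
    show "degree p = m \<and> lead_coeff p = 1 \<and> L p = smult (g m) p"
      using deg \<open>coeff p m = 1\<close> Lp by simp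
  next
    fix q assume q: "degree q = m \<and> lead_coeff q = 1 \<and> L q = smult (g m) q"
    define d where "d = q - p"
    have Ld: "L d = smult (g m) d"
      using q Lp by (simp add: d_def diff smult_diff_right)
    have dm: "coeff d m = 0" using q \<open>coeff p m = 1\<close> by (auto simp: d_def)
    have "degree d \<le> m" using q deg by (auto simp: d_def intro: degree_diff_le)
    show "q = p"
    proof (rule ccontr)
      assume "q \<noteq> p"
      then have "d \<noteq> 0" by (simp add: d_def)
      then have lead: "lead_coeff d \<noteq> 0" by simp
      have "coeff (L d) (degree d) = g (degree d) * lead_coeff d"
        by (rule coeff_image) (simp add: coeff_eq_0)
      then have "g (degree d) = g m" using Ld lead by simp
      then have "degree d = m" using inj_g by (auto dest: injD)
      then show False using lead dm by simp
    qed
  qed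
qed

end

lemma monic_basis_induct [consumes 2, case_names zero add]:
  fixes p :: "nat \<Rightarrow> 'a::field poly"
  assumes "\<And>m. degree (p m) = m" "\<And>m. lead_coeff (p m) = 1"
    and zero: "P 0" and add: "\<And>f c m. P f \<Longrightarrow> P (f + smult c (p m))"
  shows "P f"
proof -
  have "P f" if "\<And>k. k \<ge> n \<Longrightarrow> coeff f k = 0" for f n
    using that
  proof (induction n arbitrary: f)
    case 0
    then have "f = 0" by (simp add: poly_eq_iff)
    then show ?case using zero by simp
  next
    case (Suc n)
    let ?f = "f - smult (coeff f n) (p n)"
    have "coeff (p n) k = (if k = n then 1 else 0)" if "k \<ge> n" for k
      using that assms(1,2)[of n] by (auto simp: coeff_eq_0)
    then have "P ?f" using Suc.prems by (intro Suc.IH) auto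
    from add[OF this, of "coeff f n" n] show ?case by simp
  qed
  from this[of "Suc (degree f)"] show ?thesis by (simp add: coeff_eq_0)
qed

lemma eigenvectors_sum_zero:
  fixes L :: "'a::field poly \<Rightarrow> 'a poly"
  assumes lin: "Vector_Spaces.linear smult smult L" and "inj_on \<mu> S" "finite S"
    and "\<And>n. n \<in> S \<Longrightarrow> L (d n) = smult (\<mu> n) (d n)" "sum d S = 0" "n \<in> S"
  shows "d n = 0"
proof -
  interpret Vector_Spaces.linear smult smult L by (rule lin)
  have "\<forall>n\<in>S. d n = 0"
    using assms(3,2,4,5)
  proof (induction S arbitrary: d rule: finite_induct)
    case (insert a S)
    \<comment> \<open>Applying \<open>L - \<mu> a\<close> kills the \<open>a\<close> term and
      multiplies each other term by a nonzero scalar, which reduces the relation to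
      \<open>S\<close>.\<close>
    have "(\<Sum>n\<in>S. smult (\<mu> n - \<mu> a) (d n)) = (\<Sum>n\<in>insert a S. smult (\<mu> n - \<mu> a) (d n))"
      using insert.hyps by simp
    also have "\<dots> = (\<Sum>n\<in>insert a S. L (d n) - smult (\<mu> a) (d n))"
      using insert.prems(2) by (intro sum.cong) (simp_all only: smult_diff_left)
    also have "\<dots> = L (sum d (insert a S)) - smult (\<mu> a) (sum d (insert a S))"
      by (simp only: sum_subtractf sum[symmetric] vs1.scale_sum_right[symmetric])
    also have "\<dots> = 0" by (simp only: insert.prems(3)) simp
    finally have "\<forall>n\<in>S. smult (\<mu> n - \<mu> a) (d n) = 0"
      using insert.prems by (intro insert.IH) (auto simp: scale)
    then have "\<forall>n\<in>S. d n = 0" using insert.prems(1) insert.hyps by (auto simp: inj_on_def)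
    then show ?case using insert.prems(3) insert.hyps by simp
  qed simp
  then show ?thesis using assms(6) by blast
qed

section \<open>Action of \<open>Y\<close> on monomials\<close>

text \<open>Both difference operators divide a monic quadratic times a difference \<open>D\<close>
  by a linear polynomial; the two top coefficients of the quotient decide triangularity.
  \<open>coeff (pCons 0 D) m\<close> is the coefficient of \<open>D\<close> at \<open>m - 1\<close>,
  read as 0 when \<open>m = 0\<close>.\<close>

lemma quadratic_mult_linear_div_coeffs:
  fixes D Q :: "'a::field poly"
  assumes "[:e, d:] * Q = [:c, b, 1:] * D" "d \<noteq> 0" and deg: "degree D \<le> m"
  shows "\<And>k. k > Suc m \<Longrightarrow> coeff Q k = 0"
    and "d * coeff Q (Suc m) = coeff D m"
    and "d * coeff Q m = b * coeff D m + coeff (pCons 0 D) m - e * coeff Q (Suc m)"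
proof -
  have D0: "coeff D k = 0" if "k > m" for k using that deg by (simp add: coeff_eq_0)
  have rel: "e * coeff Q (Suc k) + d * coeff Q k =
      c * coeff D (Suc k) + b * coeff D k + coeff (pCons 0 D) k" for k
    using arg_cong[OF assms(1), of "\<lambda>p. coeff p (Suc k)"] by (cases k) (simp_all add: algebra_simps)
  have degQ: "degree Q \<le> Suc m"
  proof (cases "D = 0")
    case True
    then have "Q = 0" using assms(1,2)
      by (metis mult_zero_right no_zero_divisors pCons_eq_0_iff)
    then show ?thesis by simp
  next
    case False
    then have "Q \<noteq> 0" using assms(1) by (metis mult_zero_right no_zero_divisors one_neq_zero pCons_eq_0_iff)
    with False have "degree ([:e, d:] * Q) = degree Q + 1" "degree ([:c, b, 1:] * D) = degree D + 2"
      using assms(2) by (simp_all add: degree_mult_eq del: mult_pCons_left)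
    then show ?thesis using assms(1) deg by simp
  qed
  then show Q0: "\<And>k. k > Suc m \<Longrightarrow> coeff Q k = 0" by (simp add: coeff_eq_0)
  show "d * coeff Q (Suc m) = coeff D m" using rel[of "Suc m"] by (simp add: D0 Q0)
  show "d * coeff Q m = b * coeff D m + coeff (pCons 0 D) m - e * coeff Q (Suc m)"
    using rel[of m] by (simp add: D0 algebra_simps)
qed

lemma pcompose_monom_1: "pcompose (monom 1 m) q = q ^ m"
  by (induction m) (simp_all add: monom_Suc pcompose_pCons pcompose_1)

text \<open>For odd \<open>m\<close> each summand of \<open>opY\<close> raises the degree by one,
  and these leading terms cancel only in the sum. The parity of \<open>m\<close> produces the two
  branches of \<open>wilson_gamma\<close>.\<close>

lemma coeff_opY_monom:
  assumes "k \<ge> m"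
  shows "coeff (opY t0 u0 t1 u1 (monom 1 m)) k = (if k = m then wilson_gamma t0 t1 m else 0)"
proof -
  define D0 :: "complex poly" where "D0 = pcompose (monom 1 m) [:1, -1:] - monom 1 m"
  define D1 :: "complex poly" where "D1 = pcompose (monom 1 m) [:0, -1:] - monom 1 m"
  define Q0 where "Q0 = ([:t0 + u0 + 1/2, -1:] * [:t0 - u0 + 1/2, -1:] * D0) div [:1, -2:]"
  define Q1 where "Q1 = ([:t1 + u1, 1:] * [:t1 - u1, 1:] * D1) div [:0, 2:]"
  have D0: "D0 = [:1, -1:] ^ m - monom 1 m" and D1: "D1 = [:0, -1:] ^ m - monom 1 m"
    by (simp_all add: D0_def D1_def pcompose_monom_1)
  have deg: "degree D0 \<le> m" "degree D1 \<le> m"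
    unfolding D0 D1 using degree_power_le[of "[:1, -1::complex:]" m] degree_power_le[of "[:0, -1::complex:]" m]
    by (auto intro!: degree_diff_le degree_monom_le)
  \<comment> \<open>The differences vanish at the fixed points \<open>1/2\<close> and
    \<open>0\<close> of the two reflections, so the divisions are exact.\<close>
  have "[:1, -2:] dvd D0" "[:0, 2:] dvd D1"
    unfolding D0_def D1_def by (rule linear_factor_dvd; simp add: poly_pcompose)+
  then have "[:1, -2:] * Q0 = [:t0 + u0 + 1/2, -1:] * [:t0 - u0 + 1/2, -1:] * D0"
      "[:0, 2:] * Q1 = [:t1 + u1, 1:] * [:t1 - u1, 1:] * D1"
    unfolding Q0_def Q1_def by (metis dvd_mult dvd_mult_div_cancel)+
  moreover have "[:t0 + u0 + 1/2, -1:] * [:t0 - u0 + 1/2, -1:] =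
      [:(t0 + u0 + 1/2) * (t0 - u0 + 1/2), - (2 * t0 + 1), 1:]"
    "[:t1 + u1, 1:] * [:t1 - u1, 1:] = [:(t1 + u1) * (t1 - u1), 2 * t1, 1:]"
    by (simp_all add: algebra_simps)
  ultimately have
    Q0: "[:1, -2:] * Q0 = [:(t0 + u0 + 1/2) * (t0 - u0 + 1/2), - (2 * t0 + 1), 1:] * D0"
    and Q1: "[:0, 2:] * Q1 = [:(t1 + u1) * (t1 - u1), 2 * t1, 1:] * D1"
    by metis+
  have q0: "\<And>k. k > Suc m \<Longrightarrow> coeff Q0 k = 0" "- 2 * coeff Q0 (Suc m) = coeff D0 m"
    "- 2 * coeff Q0 m = - (2 * t0 + 1) * coeff D0 m + coeff (pCons 0 D0) m - 1 * coeff Q0 (Suc m)"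
    by (rule quadratic_mult_linear_div_coeffs[OF Q0 _ deg(1)]; simp)+
  have q1: "\<And>k. k > Suc m \<Longrightarrow> coeff Q1 k = 0" "2 * coeff Q1 (Suc m) = coeff D1 m"
    "2 * coeff Q1 m = 2 * t1 * coeff D1 m + coeff (pCons 0 D1) m - 0 * coeff Q1 (Suc m)"
    by (rule quadratic_mult_linear_div_coeffs[OF Q1 _ deg(2)]; simp)+
  \<comment> \<open>Top coefficients of \<open>(1 - x)^m - x^m\<close> and
    \<open>(-x)^m - x^m\<close>; at \<open>m = 0\<close> the factor \<open>of_nat m\<close> is 0, so
    the truncated exponent \<open>m - 1\<close> is harmless.\<close>
  have c: "coeff D0 m = (-1) ^ m - 1" "coeff D1 m = (-1) ^ m - 1"
    "coeff (pCons 0 D0) m = of_nat m * (-1) ^ (m - 1)" "coeff (pCons 0 D1) m = 0"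
    unfolding D0 D1 by (cases m; simp add: coeff_linear_poly_power del: power_Suc)+
  have Y: "opY t0 u0 t1 u1 (monom 1 m) = smult (t0 + t1) (monom 1 m) + Q0 + Q1"
    unfolding opY_def opT0_def opT1_def Q0_def Q1_def D0_def D1_def by (simp add: smult_add_left)
  consider "k > Suc m" | "k = Suc m" | "k = m" using assms by linarith
  then show ?thesis
  proof cases
    case 1
    then show ?thesis by (simp add: Y q0 q1)
  next
    case 2
    have "2 * (coeff Q0 (Suc m) + coeff Q1 (Suc m)) = 0"
      using q0(2) q1(2) c by (cases "even m") (auto simp: algebra_simps)
    then have "coeff Q0 (Suc m) + coeff Q1 (Suc m) = 0"
      by (metis mult_eq_0_iff zero_neq_numeral)
    then show ?thesis by (simp add: Y 2)
  next
    case 3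
    have Ym: "coeff (opY t0 u0 t1 u1 (monom 1 m)) m = t0 + t1 + coeff Q0 m + coeff Q1 m"
      by (simp add: Y)
    show ?thesis
    proof (cases "even m")
      case True
      then obtain n where m: "m = 2 * n" by (elim evenE)
      have D: "coeff D0 m = 0" "coeff D1 m = 0" "coeff (pCons 0 D0) m = - (2 * of_nat n)"
        unfolding c by (cases n; simp add: m)+
      have "coeff Q0 (Suc m) = 0" using q0(2) D by simp
      then have "2 * coeff Q0 m = 2 * of_nat n" using q0(3) D by simp
      then have "coeff Q0 m = of_nat n" by (simp only: mult_cancel_left) simp
      moreover have "coeff Q1 m = 0" using q1(3) D c(4) by simp
      ultimately show ?thesis unfolding 3 Ym by (simp add: wilson_gamma_def m)
    next
      case False
      then obtain n where m: "m = 2 * n + 1" by (elim oddE)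
      have D: "coeff D0 m = - 2" "coeff D1 m = - 2" "coeff (pCons 0 D0) m = 2 * of_nat n + 1"
        unfolding c by (simp_all add: m)
      have "coeff Q0 (Suc m) = 1" using q0(2) D by simp
      then have "- 2 * coeff Q0 m = - 2 * (- 2 * t0 - 1 - of_nat n)"
        using q0(3) unfolding D by (simp add: algebra_simps)
      then have "coeff Q0 m = - 2 * t0 - 1 - of_nat n" by (simp only: mult_cancel_left) simp
      moreover have "2 * coeff Q1 m = 2 * (- 2 * t1)"
        using q1(3) unfolding D c(4) by (simp add: algebra_simps)
      then have "coeff Q1 m = - 2 * t1" by (simp only: mult_cancel_left) simp
      ultimately show ?thesis unfolding 3 Ym by (simp add: wilson_gamma_def m)
    qed
  qed
qed


section \<open>Polynomials in \<open>\<xi>\<close> and the center of \<open>\<complex>[\<W>]\<close>\<close>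

lemma walg_eval_0 [simp]: "walg_eval 0 a = 0"
  by (simp add: walg_eval_def walg_scale_def)

lemma walg_scale_comm: "walg_scale c a * b = walg_scale c (a * b)" "a * walg_scale c b = walg_scale c (a * b)"
proof -
  have comm: "a * Poly_Mapping.single 0 c = Poly_Mapping.single 0 c * a" for a :: walg
    by (induction a rule: walg_induct) (simp_all add: mult_single algebra_simps)
  show "walg_scale c a * b = walg_scale c (a * b)" by (simp add: walg_scale_def mult.assoc)
  show "a * walg_scale c b = walg_scale c (a * b)"
    by (metis walg_scale_def comm mult.assoc)
qed

lemma walg_scale_algebra:
  "walg_scale c (a + b) = walg_scale c a + walg_scale c b"
  "walg_scale (c + d) a = walg_scale c a + walg_scale d a"
  "walg_scale c (walg_scale d a) = walg_scale (c * d) a"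
  "walg_scale 0 a = 0" "walg_scale c 0 = 0" "walg_scale 1 a = a"
  by (simp_all add: walg_scale_def algebra_simps single_add mult_single flip: mult.assoc)

lemma walg_scale_sum: "walg_scale c (sum f S) = (\<Sum>k\<in>S. walg_scale c (f k))"
  by (simp add: walg_scale_def sum_distrib_left)

lemma walg_eval_altdef:
  assumes "degree p \<le> n"
  shows "walg_eval p a = (\<Sum>k\<le>n. walg_scale (coeff p k) (a ^ k))"
  unfolding walg_eval_def
  by (rule sum.mono_neutral_left) (use assms in \<open>auto simp: coeff_eq_0 walg_scale_algebra\<close>)

lemma walg_eval_pCons [simp]: "walg_eval (pCons c p) a = walg_scale c 1 + a * walg_eval p a"
proof -
  have "walg_eval (pCons c p) a = (\<Sum>k\<le>Suc (degree p). walg_scale (coeff (pCons c p) k) (a ^ k))"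
    by (rule walg_eval_altdef) (simp add: degree_pCons_le)
  also have "\<dots> = walg_scale c 1 + a * walg_eval p a"
    by (simp add: sum.atMost_Suc_shift walg_eval_def sum_distrib_left walg_scale_comm del: sum.atMost_Suc)
  finally show ?thesis .
qed

lemma walg_eval_add: "walg_eval (p + q) a = walg_eval p a + walg_eval q a"
proof -
  let ?n = "max (degree p) (degree q)"
  have "degree (p + q) \<le> ?n" by (rule degree_add_le_max)
  then show ?thesis
    by (simp add: walg_eval_altdef[of _ ?n] walg_scale_algebra sum.distrib)
qed

lemma walg_eval_smult: "walg_eval (smult c p) a = walg_scale c (walg_eval p a)"
  by (simp add: walg_eval_altdef[of _ "degree p"] degree_smult_le walg_scale_algebra walg_scale_sum)

lemma walg_eval_minus: "walg_eval (- p) a = - walg_eval p a"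
  using walg_eval_add[of p "- p" a] by (simp add: eq_neg_iff_add_eq_0 add.commute)

lemma walg_eval_commute: "a * walg_eval p a = walg_eval p a * a"
  by (induction p) (simp_all add: distrib_left distrib_right walg_scale_comm, metis mult.assoc)

text \<open>As \<open>t0\<close> and \<open>t1\<close> are invertible, each group generator is a
  scalar multiple of \<open>sigma0 t0\<close> or \<open>sigma1 t1\<close>, so left multiplication by
  these two reaches every group element.\<close>

lemma walg_generated_induct [consumes 2, case_names one scale add sigma0 sigma1]:
  fixes a :: walg
  assumes "t0 \<noteq> 0" "t1 \<noteq> 0" and one: "P 1"
    and scale: "\<And>c a. P a \<Longrightarrow> P (walg_scale c a)"
    and add: "\<And>a b. P a \<Longrightarrow> P b \<Longrightarrow> P (a + b)"
    and sigma0: "\<And>a. P a \<Longrightarrow> P (sigma0 t0 * a)"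
    and sigma1: "\<And>a. P a \<Longrightarrow> P (sigma1 t1 * a)"
  shows "P a"
proof -
  have word: "P (Poly_Mapping.single w 1)" for w
  proof (induction w rule: wgrp_induct)
    case zero
    show ?case using one by simp
  next
    case (gen i w)
    define b :: walg where "b = Poly_Mapping.single w 1"
    have "Poly_Mapping.single (wgen i + w) 1 =
        (case i of S0 \<Rightarrow> walg_scale (1 / t0) (sigma0 t0 * b) | S1 \<Rightarrow> walg_scale (1 / t1) (sigma1 t1 * b))"
      using assms(1,2) by (cases i) (simp_all add: b_def sigma0_def sigma1_def mult_single walg_scale_single)
    moreover have "P b" using gen by (simp add: b_def)
    ultimately show ?case by (cases i) (auto intro: scale sigma0 sigma1)
  qed
  show ?thesis
  proof (induction a rule: walg_induct)
    case zero
    show ?case using scale[OF one, of 0] by (simp add: walg_scale_algebra)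
  next
    case (single w c)
    show ?case using scale[OF word[of w], of c] by (simp add: walg_scale_single)
  qed (rule add)
qed

lemma sigma_square:
  "sigma0 t0 * sigma0 t0 = walg_scale (t0\<^sup>2) 1" "sigma1 t1 * sigma1 t1 = walg_scale (t1\<^sup>2) 1"
  using wgen_involution walg_scale_single[of _ 0 1]
  by (simp_all add: sigma0_def sigma1_def mult_single power2_eq_square)

text \<open>Expanding \<open>(xi - sigma0)^2 = sigma1^2\<close>, where \<open>sigma0\<close> and
  \<open>sigma1\<close> have scalar squares, gives the rule for moving \<open>xi\<close> to the
  right past \<open>sigma0\<close>.\<close>

lemma xi_sigma0:
  "xi t0 t1 * sigma0 t0 = xi t0 t1 * xi t0 t1 + walg_scale (t0\<^sup>2 - t1\<^sup>2) 1 - sigma0 t0 * xi t0 t1"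
proof -
  have "walg_scale (t0\<^sup>2) 1 = walg_scale (t0\<^sup>2 - t1\<^sup>2) 1 + walg_scale (t1\<^sup>2) 1"
    by (simp flip: walg_scale_algebra(2))
  then show ?thesis
    by (simp add: xi_def distrib_left distrib_right sigma_square)
qed

text \<open>The set of such sums contains 1 and is stable under left multiplication by
  \<open>sigma0\<close> and \<open>xi\<close>, hence by \<open>sigma1 = xi - sigma0\<close>.\<close>

lemma walg_xi_decomposition:
  assumes "t0 \<noteq> 0" "t1 \<noteq> 0"
  obtains p q where "a = walg_eval p (xi t0 t1) + sigma0 t0 * walg_eval q (xi t0 t1)"
proof -
  let ?x = "xi t0 t1" and ?s = "sigma0 t0"
  define S where "S = {walg_eval p ?x + ?s * walg_eval q ?x | p q. True}"
  have I: "walg_eval p ?x + ?s * walg_eval q ?x \<in> S" for p q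
    unfolding S_def by blast
  have add: "a + b \<in> S" if ab: "a \<in> S" "b \<in> S" for a b
  proof -
    obtain p q p' q' where "a = walg_eval p ?x + ?s * walg_eval q ?x"
        "b = walg_eval p' ?x + ?s * walg_eval q' ?x"
      using ab by (auto simp: S_def)
    then have "a + b = walg_eval (p + p') ?x + ?s * walg_eval (q + q') ?x"
      by (simp add: walg_eval_add algebra_simps)
    then show ?thesis using I by metis
  qed
  have scale: "walg_scale c a \<in> S" if a: "a \<in> S" for c a
  proof -
    obtain p q where "a = walg_eval p ?x + ?s * walg_eval q ?x"
      using a by (auto simp: S_def)
    then have "walg_scale c a = walg_eval (smult c p) ?x + ?s * walg_eval (smult c q) ?x"
      by (simp add: walg_eval_smult walg_scale_algebra walg_scale_comm)
    then show ?thesis using I by metis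
  qed
  have s0: "?s * a \<in> S" if a: "a \<in> S" for a
  proof -
    obtain p q where "a = walg_eval p ?x + ?s * walg_eval q ?x"
      using a by (auto simp: S_def)
    then have "?s * a = walg_eval (smult (t0\<^sup>2) q) ?x + ?s * walg_eval p ?x"
      by (simp add: walg_eval_smult distrib_left walg_scale_comm sigma_square flip: mult.assoc)
    then show ?thesis using I by metis
  qed
  have x: "?x * a \<in> S" if a: "a \<in> S" for a
  proof -
    obtain p q where a': "a = walg_eval p ?x + ?s * walg_eval q ?x"
      using a by (auto simp: S_def)
    define c where "c = t0\<^sup>2 - t1\<^sup>2"
    have "?x * a = ?x * walg_eval p ?x + (?x * ?s) * walg_eval q ?x"
      using a' by (simp add: distrib_left mult.assoc)
    \<comment> \<open>The exchange rule turns \<open>xi * sigma0 * q(xi)\<close> into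
      \<open>(xi^2 + c) * q(xi) - sigma0 * xi * q(xi)\<close>; multiplication by \<open>xi\<close>
      becomes \<open>pCons 0\<close>.\<close>
    also have "\<dots> = walg_eval (pCons 0 p + pCons 0 (pCons 0 q) + smult c q) ?x +
        ?s * walg_eval (- pCons 0 q) ?x"
      unfolding xi_sigma0 c_def[symmetric]
      by (simp add: walg_eval_add walg_eval_smult walg_eval_minus walg_scale_algebra walg_scale_comm algebra_simps)
    finally show ?thesis using I by metis
  qed
  have "a \<in> S"
    using assms
  proof (induction a rule: walg_generated_induct)
    case one
    show ?case using I[of 1 0] by (simp add: one_pCons walg_scale_algebra)
  next
    case (sigma1 a)
    have "sigma1 t1 * a = ?x * a + walg_scale (-1) (?s * a)"
      by (simp add: xi_def walg_scale_def distrib_right single_uminus)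
    then show ?case using sigma1 by (simp add: add scale x s0)
  qed (auto intro: add scale s0)
  then show thesis using that by (auto simp: S_def)
qed

lemma walg_centerI:
  assumes "t0 \<noteq> 0" "t1 \<noteq> 0" "z * sigma0 t0 = sigma0 t0 * z" "z * xi t0 t1 = xi t0 t1 * z"
  shows "z \<in> walg_center"
  unfolding walg_center_def
proof (intro CollectI allI)
  fix a
  obtain p q where a: "a = walg_eval p (xi t0 t1) + sigma0 t0 * walg_eval q (xi t0 t1)"
    using walg_xi_decomposition[OF assms(1,2)] .
  have "z * walg_eval r (xi t0 t1) = walg_eval r (xi t0 t1) * z" for r
    by (induction r) (simp_all add: distrib_left distrib_right walg_scale_comm,
      metis assms(4) mult.assoc)
  then show "z * a = a * z"
    unfolding a by (simp add: distrib_left distrib_right) (metis assms(3) mult.assoc)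
qed

text \<open>Moving \<open>xi\<close> past \<open>sigma0\<close> twice restores the sign, and the
  extra terms \<open>xi^2 + c\<close> cancel because they commute with \<open>xi\<close>. So
  \<open>xi^2\<close>, and every polynomial in it, commutes with \<open>sigma0\<close>.\<close>

lemma walg_eval_even_center:
  assumes "t0 \<noteq> 0" "t1 \<noteq> 0" "p \<in> even_polys"
  shows "walg_eval p (xi t0 t1) \<in> walg_center"
proof (rule walg_centerI[OF assms(1,2)])
  let ?x = "xi t0 t1" and ?s = "sigma0 t0"
  have xx: "(?x * ?x) * ?s = ?s * (?x * ?x)"
  proof -
    define c where "c = t0\<^sup>2 - t1\<^sup>2"
    have anti: "?x * ?s = ?x * ?x + walg_scale c 1 - ?s * ?x"
      unfolding c_def by (rule xi_sigma0)
    have "(?x * ?x) * ?s = ?x * (?x * ?x + walg_scale c 1 - ?s * ?x)"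
      by (simp only: anti mult.assoc)
    also have "\<dots> = ?x * ?x * ?x + walg_scale c ?x - (?x * ?s) * ?x"
      by (simp add: algebra_simps walg_scale_comm)
    also have "\<dots> = ?s * (?x * ?x)"
      unfolding anti by (simp add: algebra_simps walg_scale_comm)
    finally show ?thesis .
  qed
  obtain q where q: "p = pcompose q (monom 1 2)" using assms(3) by (auto simp: even_polys_def)
  show "walg_eval p ?x * ?s = ?s * walg_eval p ?x"
    unfolding q
  proof (induction q)
    case (pCons c q)
    let ?e = "walg_eval (pcompose q (monom 1 2)) ?x"
    have "walg_eval (pcompose (pCons c q) (monom 1 2)) ?x = walg_scale c 1 + ?x * ?x * ?e"
      by (simp add: pcompose_pCons walg_eval_add numeral_2_eq_2 monom_Suc walg_scale_algebra mult.assoc)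
    moreover have "(?x * ?x * ?e) * ?s = ?s * (?x * ?x * ?e)"
    proof -
      have "(?x * ?x * ?e) * ?s = (?x * ?x) * (?s * ?e)" by (simp only: mult.assoc pCons.IH)
      also have "\<dots> = (?s * (?x * ?x)) * ?e" by (simp only: xx flip: mult.assoc)
      finally show ?thesis by (simp only: mult.assoc)
    qed
    ultimately show ?case by (simp add: distrib_left distrib_right walg_scale_comm)
  qed simp
  show "walg_eval p ?x * ?x = ?x * walg_eval p ?x" by (simp add: walg_eval_commute)
qed


section \<open>The module \<open>\<A>\<close> for generic parameters\<close>

lemma opY_linear: "Vector_Spaces.linear smult smult (opY t0 u0 t1 u1)"
  using opT0_linear[of t0 u0] opT1_linear[of t1 u1]
  by (simp add: Vector_Spaces.linear_iff opY_def smult_add_right)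

text \<open>\<open>opT1\<close> also acts on \<open>f\<close> by a scalar, \<open>c - a\<close>; as
  the operators square to \<open>t0^2\<close> and \<open>t1^2\<close>, \<open>a\<close> is
  \<open>t0\<close> up to sign and \<open>c - a\<close> is \<open>t1\<close> up to sign.\<close>

lemma opY_opT0_eigenvalues:
  assumes "f \<noteq> 0" "opY t0 u0 t1 u1 f = smult c f" "opT0 t0 u0 f = smult a f"
  shows "c \<in> {t0 + t1, t0 - t1, - t0 + t1, - t0 - t1}"
proof -
  have T1: "opT1 t1 u1 f = smult (c - a) f"
    using assms(2,3) by (simp add: opY_def smult_diff_left algebra_simps)
  have "smult (a\<^sup>2) f = smult (t0\<^sup>2) f"
    using opT0_square[of t0 u0 f] opT0_linear[of t0 u0] assms(3)
    by (simp add: Vector_Spaces.linear_iff power2_eq_square)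
  moreover have "smult ((c - a)\<^sup>2) f = smult (t1\<^sup>2) f"
    using opT1_square[of t1 u1 f] opT1_linear[of t1 u1] T1
    by (simp add: Vector_Spaces.linear_iff power2_eq_square)
  ultimately have "a = t0 \<or> a = - t0" "c - a = t1 \<or> c - a = - t1"
    using \<open>f \<noteq> 0\<close> by (auto simp: smult_eq_iff power2_eq_iff simp flip: smult_diff_left)
  then show ?thesis by (auto simp: algebra_simps)
qed

locale generic_wilson =
  fixes t0 u0 t1 u1 :: complex
  assumes nonzero: "t0 \<noteq> 0" "t1 \<noteq> 0"
    and generic: "n \<ge> 1 \<Longrightarrow> t0 + t1 \<noteq> - (of_nat n / 2)"
begin

abbreviation "\<gamma> \<equiv> wilson_gamma t0 t1"
abbreviation "pw \<equiv> wilson_poly t0 u0 t1 u1"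
abbreviation "V \<equiv> wilson_space t0 u0 t1 u1"
abbreviation "\<rho> \<equiv> pi_rep t0 u0 t1 u1"
abbreviation "T \<equiv> opT0 t0 u0"
abbreviation "Y \<equiv> opY t0 u0 t1 u1"
abbreviation "\<xi> \<equiv> xi t0 t1"

section \<open>The spectrum of \<open>Y\<close>\<close>

lemma twice_sum_neq: "n \<ge> 1 \<Longrightarrow> 2 * (t0 + t1) + of_nat n \<noteq> 0"
  using generic[of n] by (auto simp: eq_neg_iff_add_eq_0 field_simps)

lemma gamma_even: "\<gamma> (2 * n) = t0 + t1 + of_nat n"
  by (simp add: wilson_gamma_def)

lemma gamma_odd: "n \<ge> 1 \<Longrightarrow> \<gamma> (2 * n - Suc 0) = - \<gamma> (2 * n)"
  by (auto simp: wilson_gamma_def)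

text \<open>The sum \<open>\<gamma> (2 * n) + \<gamma> (2 * m)\<close> is
  \<open>2 * (t0 + t1) + n + m\<close>. Genericity keeps it nonzero except at
  \<open>n = m = 0\<close>, where \<open>t0 + t1 = 0\<close> is allowed.\<close>

lemma gamma_even_neq_neg: "n + m \<ge> 1 \<Longrightarrow> \<gamma> (2 * n) \<noteq> - \<gamma> (2 * m)"
  using twice_sum_neq[of "n + m"] unfolding gamma_even eq_neg_iff_add_eq_0 by (simp add: algebra_simps)

lemma nat_even_or_pred: obtains n where "m = 2 * n" | n where "n \<ge> 1" "m = 2 * n - (1::nat)"
proof (cases "even m")
  case False
  then obtain n where "m = 2 * n + 1" by (elim oddE)
  then show thesis using that(2)[of "Suc n"] by simp
qed (auto elim: evenE that)

lemma inj_gamma: "inj \<gamma>"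
proof (rule injI)
  fix m m' assume eq: "\<gamma> m = \<gamma> m'"
  show "m = m'"
  proof (cases m rule: nat_even_or_pred; cases m' rule: nat_even_or_pred)
    fix n n' assume "m = 2 * n" "m' = 2 * n'"
    then show ?thesis using eq by (simp add: gamma_even)
  next
    fix n n' assume "m = 2 * n" "n' \<ge> 1" "m' = 2 * n' - 1"
    then show ?thesis using eq gamma_even_neq_neg[of n n'] by (simp add: gamma_odd)
  next
    fix n n' assume "n \<ge> 1" "m = 2 * n - 1" "m' = 2 * n'"
    then show ?thesis using eq gamma_even_neq_neg[of n' n] by (simp add: gamma_odd)
  next
    fix n n' assume "n \<ge> 1" "m = 2 * n - 1" "n' \<ge> 1" "m' = 2 * n' - 1"
    then show ?thesis using eq by (simp add: gamma_odd gamma_even)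
  qed
qed

lemma inj_gamma_square: "inj (\<lambda>n. (\<gamma> (2 * n))\<^sup>2)"
proof (rule injI)
  fix m n assume "(\<gamma> (2 * m))\<^sup>2 = (\<gamma> (2 * n))\<^sup>2"
  then have "\<gamma> (2 * m) = \<gamma> (2 * n) \<or> \<gamma> (2 * m) = - \<gamma> (2 * n)" by (simp add: power2_eq_iff)
  then show "m = n"
    using gamma_even_neq_neg[of m n] inj_gamma by (cases "m + n \<ge> 1") (auto dest: injD)
qed

text \<open>Supplies existence and uniqueness of the monic eigenpolynomials, which makes the
  definite description in \<open>wilson_poly\<close> meaningful.\<close>

sublocale Y: triangular_operator Y \<gamma>
proof -
  interpret Vector_Spaces.linear smult smult Y by (rule opY_linear)
  show "triangular_operator Y \<gamma>"
    by unfold_locales (auto simp: coeff_opY_monom inj_gamma)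
qed

section \<open>Eigenpolynomials and the action of \<xi>\<close>

lemma wilson_poly_properties:
  "degree (pw m) = m" "lead_coeff (pw m) = 1" "Y (pw m) = smult (\<gamma> m) (pw m)"
  using theI'[OF Y.monic_eigenpoly_ex1[of m], folded wilson_poly_def] by blast+

lemma wilson_poly_neq_0 [simp]: "pw m \<noteq> 0"
  using wilson_poly_properties(2)[of m] by auto

lemma rep: "walg_rep \<rho>" and rep_sigma0: "\<rho> (sigma0 t0) = T"
  and rep_sigma1: "\<rho> (sigma1 t1) = opT1 t1 u1"
  using pi_rep_properties[OF nonzero, of u0 u1] by blast+

lemma rep_simps: "\<rho> (a + b) f = \<rho> a f + \<rho> b f" "\<rho> (walg_scale c a) f = smult c (\<rho> a f)"
    "\<rho> (a * b) f = \<rho> a (\<rho> b f)" "\<rho> 1 f = f"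
    "\<rho> a (f + h) = \<rho> a f + \<rho> a h" "\<rho> a (smult c f) = smult c (\<rho> a f)"
  using rep by (simp_all add: walg_rep_def Vector_Spaces.linear_iff)

lemma rep_xi: "\<rho> \<xi> f = Y f"
  by (simp add: xi_def rep_simps rep_sigma0 rep_sigma1 opY_def)

lemma rep_walg_eval:
  assumes "Y f = smult c f"
  shows "\<rho> (walg_eval q \<xi>) f = smult (poly q c) f"
proof (induction q)
  case 0
  show ?case using rep_simps(2)[of 0 1 f] by (simp add: walg_scale_algebra)
qed (simp_all add: rep_simps rep_xi assms Y.scale smult_add_left mult.commute)

section \<open>Faithfulness\<close>

lemma rep_faithful: "faithful_rep \<rho>"
proof -
  have zero: "a = 0" if a: "\<And>f. \<rho> a f = 0" for a
  proof -
    obtain q r where qr: "a = walg_eval q \<xi> + sigma0 t0 * walg_eval r \<xi>"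
      using walg_xi_decomposition[OF nonzero] .
    define E where "E = {t0 + t1, t0 - t1, - t0 + t1, - t0 - t1}"
    have roots: "poly q (\<gamma> m) = 0 \<and> poly r (\<gamma> m) = 0" if m: "\<gamma> m \<notin> E" for m
    proof -
      let ?c = "poly q (\<gamma> m)" and ?d = "poly r (\<gamma> m)"
      have eq: "smult ?c (pw m) + smult ?d (T (pw m)) = 0"
        using a[of "pw m"] wilson_poly_properties(3)[of m]
        by (simp add: qr rep_simps rep_walg_eval rep_sigma0 flip: rep_sigma0)
      \<comment> \<open>With \<open>?d\<close> nonzero, \<open>pw m\<close> would be a common
        eigenvector of \<open>Y\<close> and \<open>T\<close>, forcing \<open>\<gamma> m\<close> into
        \<open>E\<close>.\<close>
      have "?d = 0"
      proof (rule ccontr)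
        assume d: "?d \<noteq> 0"
        have "smult ?d (T (pw m)) = smult (- ?c) (pw m)"
          using eq by (simp add: add_eq_0_iff)
        then have "T (pw m) = smult (- ?c / ?d) (pw m)"
          using d by (metis (no_types, lifting) divide_inverse_commute left_inverse smult_1_left smult_smult)
        then show False
          using opY_opT0_eigenvalues[of "pw m"] wilson_poly_properties(3)[of m] m
          unfolding E_def by (metis wilson_poly_neq_0)
      qed
      then show ?thesis using eq by simp
    qed
    \<comment> \<open>Injectivity gives infinitely many values and \<open>E\<close> removes at most
      four, which leaves too many roots for a nonzero polynomial.\<close>
    have inf: "infinite (range \<gamma> - E)"
      using inj_gamma by (intro Diff_infinite_finite) (auto simp: E_def finite_image_iff)
    have vanish: "s = 0" if "\<And>m. \<gamma> m \<notin> E \<Longrightarrow> poly s (\<gamma> m) = 0" for s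
    proof (rule ccontr)
      assume "s \<noteq> 0"
      moreover have "range \<gamma> - E \<subseteq> {x. poly s x = 0}" using that by auto
      ultimately show False using inf poly_roots_finite finite_subset by blast
    qed
    have "q = 0" "r = 0" using roots by (auto intro: vanish)
    then show ?thesis by (simp add: qr)
  qed
  have "inj \<rho>"
  proof (rule injI)
    fix a b assume ab: "\<rho> a = \<rho> b"
    have "\<rho> (a - b) f = 0" for f
      using rep_simps(1)[of "a - b" b f] ab by simp
    then show "a = b" using zero[of "a - b"] by simp
  qed
  then show ?thesis using rep by (simp add: faithful_rep_def)
qed

section \<open>Direct sum of the eigenspaces of \<open>Y^2\<close>\<close>

lemma wilson_poly_mem: "pw m \<in> V ((m + 1) div 2)"
  by (cases m rule: nat_even_or_pred) (auto simp: wilson_space_def intro!: cpoly.span_base)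

lemma subspace_V: "cpoly.subspace (V n)"
  by (simp add: wilson_space_def cpoly.subspace_span)

lemma V_subsetI:
  assumes "cpoly.subspace S" "pw (2 * n) \<in> S" "n \<ge> 1 \<Longrightarrow> pw (2 * n - 1) \<in> S"
  shows "V n \<subseteq> S"
  using assms by (cases "n = 0") (simp_all add: wilson_space_def cpoly.span_minimal)

lemma V_imp_eigenvector:
  assumes "f \<in> V n"
  shows "Y (Y f) = smult ((\<gamma> (2 * n))\<^sup>2) f"
proof -
  have "V n \<subseteq> {f. Y (Y f) = smult ((\<gamma> (2 * n))\<^sup>2) f}"
  proof (rule V_subsetI)
    show "cpoly.subspace {f. Y (Y f) = smult ((\<gamma> (2 * n))\<^sup>2) f}"
      by (auto simp: cpoly.subspace_def Y.add Y.scale smult_add_right mult.commute)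
  qed (simp_all add: Y.scale Y.neg wilson_poly_properties(3) gamma_odd power2_eq_square)
  then show ?thesis using assms by auto
qed

lemma Y_square_eigenvectors_sum_zero:
  assumes "finite S" "\<And>n. n \<in> S \<Longrightarrow> Y (Y (d n)) = smult ((\<gamma> (2 * n))\<^sup>2) (d n)" "sum d S = 0" "n \<in> S"
  shows "d n = 0"
proof (rule eigenvectors_sum_zero[where L = "\<lambda>f. Y (Y f)" and \<mu> = "\<lambda>n. (\<gamma> (2 * n))\<^sup>2" and S = S])
  show "Vector_Spaces.linear smult smult (\<lambda>f. Y (Y f))"
    by (simp add: Vector_Spaces.linear_iff cpoly.vector_space_axioms Y.add Y.scale)
  show "inj_on (\<lambda>n. (\<gamma> (2 * n))\<^sup>2) S" using inj_gamma_square by (rule inj_on_subset) simp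
qed (use assms in auto)

lemma decomposition_exists:
  "\<exists>g. (\<forall>n. g n \<in> V n) \<and> finite {n. g n \<noteq> 0} \<and> f = (\<Sum>n | g n \<noteq> 0. g n)"
  using wilson_poly_properties(1,2)
proof (induction f rule: monic_basis_induct)
  case zero
  show ?case using cpoly.subspace_0[OF subspace_V] by (intro exI[of _ "\<lambda>_. 0"]) simp
next
  case (add f c m)
  then obtain g where g: "\<forall>n. g n \<in> V n" "finite {n. g n \<noteq> 0}" "f = (\<Sum>n | g n \<noteq> 0. g n)"
    by blast
  \<comment> \<open>\<open>?k\<close> indexes the space holding \<open>pw m\<close>: for
    \<open>n \<ge> 1\<close> both \<open>2 * n\<close> and \<open>2 * n - 1\<close> give
    \<open>n\<close>. The new component may cancel to zero, so sums are compared over the superset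
    \<open>?S\<close> of the support.\<close>
  let ?k = "(m + 1) div 2" and ?q = "smult c (pw m)"
  let ?g = "g(?k := g ?k + ?q)" and ?S = "insert ?k {n. g n \<noteq> 0}"
  have fin: "finite ?S" using g(2) by simp
  have sub: "{n. ?g n \<noteq> 0} \<subseteq> ?S" by auto
  have "(\<Sum>n | ?g n \<noteq> 0. ?g n) = sum ?g ?S"
    by (rule sum.mono_neutral_left[OF fin sub]) auto
  also have "\<dots> = (\<Sum>n\<in>?S. g n + (if n = ?k then ?q else 0))"
    by (rule sum.cong) auto
  also have "\<dots> = sum g ?S + ?q"
    unfolding sum.distrib using fin by (subst sum.delta) simp_all
  also have "sum g ?S = f"
    unfolding g(3) by (rule sum.mono_neutral_right[OF fin]) auto
  finally have "f + ?q = (\<Sum>n | ?g n \<noteq> 0. ?g n)" by simp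
  moreover have "\<forall>n. ?g n \<in> V n"
    using g(1) wilson_poly_mem[of m] cpoly.subspace_add[OF subspace_V] cpoly.subspace_scale[OF subspace_V]
    by simp
  moreover have "finite {n. ?g n \<noteq> 0}" using fin sub by (rule rev_finite_subset)
  ultimately show ?case by blast
qed

text \<open>For uniqueness, the componentwise differences of two expansions are
  \<open>Y^2\<close>-eigenvectors for distinct eigenvalues with sum zero.\<close>

lemma V_decomposition: "direct_sum_decomposition V"
  unfolding direct_sum_decomposition_def
proof (intro conjI allI subspace_V ex_ex1I decomposition_exists)
  fix f g h
  assume g: "(\<forall>n. g n \<in> V n) \<and> finite {n. g n \<noteq> 0} \<and> f = (\<Sum>n | g n \<noteq> 0. g n)"
    and h: "(\<forall>n. h n \<in> V n) \<and> finite {n. h n \<noteq> 0} \<and> f = (\<Sum>n | h n \<noteq> 0. h n)"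
  let ?S = "{n. g n \<noteq> 0} \<union> {n. h n \<noteq> 0}"
  have fin: "finite ?S" using g h by simp
  have "sum g ?S = (\<Sum>n | g n \<noteq> 0. g n)" "sum h ?S = (\<Sum>n | h n \<noteq> 0. h n)"
    by (rule sum.mono_neutral_right[OF fin]; auto)+
  then have "sum g ?S = f" "sum h ?S = f" using g h by simp_all
  then have zero: "(\<Sum>n\<in>?S. g n - h n) = 0" by (simp add: sum_subtractf)
  have "g n - h n \<in> V n" for n using g h cpoly.subspace_diff[OF subspace_V] by blast
  then have S: "g n - h n = 0" if "n \<in> ?S" for n
    using Y_square_eigenvectors_sum_zero[OF fin _ zero that] V_imp_eigenvector by blast
  show "g = h"
  proof
    fix n show "g n = h n" using S[of n] by (cases "n \<in> ?S") auto
  qed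
qed

lemma V_iff_eigenvector: "f \<in> V n \<longleftrightarrow> Y (Y f) = smult ((\<gamma> (2 * n))\<^sup>2) f"
proof
  assume f: "Y (Y f) = smult ((\<gamma> (2 * n))\<^sup>2) f"
  obtain g where g: "\<forall>n. g n \<in> V n" "finite {n. g n \<noteq> 0}" "f = (\<Sum>n | g n \<noteq> 0. g n)"
    using decomposition_exists by blast
  let ?S = "insert n {n. g n \<noteq> 0}"
  \<comment> \<open>Subtracting \<open>f\<close> at index \<open>n\<close> keeps every component an
    eigenvector for its own eigenvalue and makes the total zero, so independence gives
    \<open>f = g n\<close>.\<close>
  define d where "d = g(n := g n - f)"
  have "sum g ?S = f" unfolding g(3) using g(2) by (intro sum.mono_neutral_right) auto
  moreover have "sum d ?S = (\<Sum>k\<in>?S. g k - (if k = n then f else 0))"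
    unfolding d_def by (rule sum.cong) auto
  then have "sum d ?S = sum g ?S - f"
    unfolding sum_subtractf using g(2) by (subst (asm) sum.delta) simp_all
  ultimately have "sum d ?S = 0" by simp
  moreover have "Y (Y (d k)) = smult ((\<gamma> (2 * k))\<^sup>2) (d k)" for k
    using V_imp_eigenvector[OF g(1)[rule_format, of k]] f
    by (cases "k = n") (simp_all add: d_def Y.diff smult_diff_right)
  ultimately have "d n = 0" using g(2) Y_square_eigenvectors_sum_zero[of ?S d n] by simp
  then have "f = g n" by (simp add: d_def)
  then show "f \<in> V n" using g(1) by simp
qed (rule V_imp_eigenvector)

lemma submodule_V: "submodule \<rho> (V n)"
  unfolding submodule_def
proof (intro conjI allI ballI subspace_V)
  fix a f assume f: "f \<in> V n"
  \<comment> \<open>Evaluating the even polynomial \<open>x^2\<close> at \<xi> shows that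
    \<open>\<xi> * \<xi>\<close> is central, so every \<open>\<rho> a\<close> commutes with
    \<open>Y^2\<close>.\<close>
  have "monom 1 2 \<in> even_polys"
    unfolding even_polys_def by (rule range_eqI[of _ _ "[:0, 1:]"]) (simp add: pcompose_pCons)
  then have "walg_eval (monom 1 2) \<xi> * a = a * walg_eval (monom 1 2) \<xi>"
    using walg_eval_even_center[OF nonzero] by (auto simp: walg_center_def)
  then have "\<xi> * \<xi> * a = a * (\<xi> * \<xi>)"
    by (simp add: numeral_2_eq_2 monom_Suc walg_scale_algebra one_pCons mult.assoc)
  from arg_cong[OF this, of "\<lambda>b. \<rho> b f"]
  have "Y (Y (\<rho> a f)) = \<rho> a (Y (Y f))" by (simp add: rep_simps rep_xi)
  then show "\<rho> a f \<in> V n" using f by (simp add: V_iff_eigenvector rep_simps)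
qed

section \<open>Irreducibility\<close>

lemma V_pos_iff:
  assumes "n \<ge> 1"
  shows "f \<in> V n \<longleftrightarrow> (\<exists>a b. f = smult a (pw (2 * n)) + smult b (pw (2 * n - 1)))"
  using assms
  by (auto simp: wilson_space_def cpoly.span_insert cpoly.span_singleton algebra_simps)

text \<open>For \<open>n \<ge> 1\<close>, projecting with \<open>Y\<close> puts one of the two
  eigenpolynomials into a nonzero submodule, and \<open>T\<close> then yields the other.\<close>

lemma irreducible_V:
  assumes t: "2 * t0 \<notin> \<int>" "2 * t1 \<notin> \<int>"
  shows "irreducible_submodule \<rho> (V n)"
  unfolding irreducible_submodule_def
proof (intro conjI allI impI submodule_V)
  have "pw (2 * n) \<in> V n" using wilson_poly_mem[of "2 * n"] by simp
  then show "V n \<noteq> {0}" using wilson_poly_neq_0[of "2 * n"] by blast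
  fix U assume U: "submodule \<rho> U" and sub: "U \<subseteq> V n"
  have Usp: "cpoly.subspace U" and Ucl: "f \<in> U \<Longrightarrow> \<rho> a f \<in> U" for a f
    using U by (auto simp: submodule_def)
  have unscale: "f \<in> U" if "smult c f \<in> U" "c \<noteq> 0" for c f
    using cpoly.subspace_scale[OF Usp that(1), of "inverse c"] that(2) by simp
  show "U = {0} \<or> U = V n"
  proof (rule disjCI)
    assume "U \<noteq> V n"
    show "U = {0}"
    proof (rule ccontr)
      assume "U \<noteq> {0}"
      then obtain u where u: "u \<in> U" "u \<noteq> 0" using cpoly.subspace_0[OF Usp] by blast
      have "V n \<subseteq> U"
      proof (cases "n = 0")
        case True
        then obtain c where c: "u = smult c (pw 0)"
          using u(1) sub by (auto simp: wilson_space_def cpoly.span_singleton)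
        then have "pw 0 \<in> U" using u unscale[of c "pw 0"] by auto
        then show ?thesis using True Usp by (intro V_subsetI) auto
      next
        case False
        then have n: "n \<ge> 1" by simp
        let ?p = "pw (2 * n)" and ?p' = "pw (2 * n - 1)" and ?c = "\<gamma> (2 * n)"
        have c: "?c \<noteq> 0" using gamma_even_neq_neg[of n n] n by auto
        obtain a b where ab: "u = smult a ?p + smult b ?p'"
          using u(1) sub V_pos_iff[OF n] by blast
        have Yu: "Y u \<in> U" using Ucl[OF u(1), of \<xi>] by (simp add: rep_xi)
        have Yab: "Y u = smult (a * ?c) ?p - smult (b * ?c) ?p'"
          unfolding ab by (simp add: Y.add Y.scale wilson_poly_properties(3) gamma_odd[OF n])
        \<comment> \<open>\<open>?c + Y\<close> and \<open>?c - Y\<close> are, up to scaling, the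
          projections onto the eigenlines for \<open>?c\<close> and \<open>- ?c\<close>.\<close>
        have "smult ?c u + Y u = smult (2 * a * ?c) ?p" "smult ?c u - Y u = smult (2 * b * ?c) ?p'"
          unfolding Yab unfolding ab
          by (simp_all only: poly_eq_iff coeff_add coeff_diff coeff_smult) (simp_all add: algebra_simps)
        then have pp': "smult (2 * a * ?c) ?p \<in> U" "smult (2 * b * ?c) ?p' \<in> U"
          using cpoly.subspace_add[OF Usp cpoly.subspace_scale[OF Usp u(1)] Yu, of ?c]
            cpoly.subspace_diff[OF Usp cpoly.subspace_scale[OF Usp u(1)] Yu, of ?c] by simp_all
        \<comment> \<open>The set is symmetric under negation, so testing \<open>?s\<close>
          suffices; the four cases contradict \<open>n \<ge> 1\<close>, the two non-integrality
          conditions and genericity.\<close>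
        have avoid: "\<gamma> m \<notin> {t0 + t1, t0 - t1, - t0 + t1, - t0 - t1}" if m: "m \<in> {2 * n, 2 * n - 1}" for m
        proof
          let ?E = "{t0 + t1, t0 - t1, - t0 + t1, - t0 - t1}" and ?s = "t0 + t1 + of_nat n"
          assume E: "\<gamma> m \<in> ?E"
          have "\<gamma> m = ?s \<or> \<gamma> m = - ?s"
            using m gamma_odd[OF n] gamma_even[of n] by auto
          moreover have "- x \<in> ?E" if "x \<in> ?E" for x using that by auto
          ultimately have "?s \<in> ?E" using E by (metis minus_minus)
          then consider "of_nat n = (0::complex)" | "2 * t1 = - of_nat n" | "2 * t0 = - of_nat n"
            | "2 * (t0 + t1) + of_nat n = 0"
            by (auto simp: algebra_simps add_eq_0_iff)
          then show False
            using n t twice_sum_neq[OF n] by cases auto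
        qed
        have swap: "pw m' \<in> U" if m: "pw m \<in> U" "{m, m'} = {2 * n, 2 * n - 1}" for m m'
        proof -
          have Tm: "T (pw m) \<in> U" using Ucl[OF m(1), of "sigma0 t0"] by (simp add: rep_sigma0)
          then obtain a b where ab: "T (pw m) = smult a (pw m) + smult b (pw m')"
            using sub V_pos_iff[OF n, of "T (pw m)"] m(2) by (auto simp: doubleton_eq_iff add.commute)
          \<comment> \<open>With \<open>b = 0\<close>, \<open>pw m\<close> would be a common
            eigenvector of \<open>Y\<close> and \<open>T\<close>, which \<open>avoid\<close> rules
            out.\<close>
          have "b \<noteq> 0"
            using opY_opT0_eigenvalues[OF _ wilson_poly_properties(3), of m a] avoid[of m] m(2) ab
            by auto
          moreover have "smult b (pw m') \<in> U"
            using cpoly.subspace_diff[OF Usp Tm cpoly.subspace_scale[OF Usp m(1), of a]] by (simp add: ab)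
          ultimately show ?thesis by (rule unscale[rotated])
        qed
        have "a \<noteq> 0 \<or> b \<noteq> 0" using u(2) ab by auto
        then have "?p \<in> U \<or> ?p' \<in> U"
          using unscale[OF pp'(1)] unscale[OF pp'(2)] c by auto
        then have "?p \<in> U \<and> ?p' \<in> U"
          using swap[of "2 * n" "2 * n - 1"] swap[of "2 * n - 1" "2 * n"] by auto
        then show ?thesis using Usp by (intro V_subsetI) auto
      qed
      then show False using sub \<open>U \<noteq> V n\<close> by blast
    qed
  qed
qed

section \<open>Non-isomorphism and the action of even polynomials\<close>

lemma V_not_isomorphic:
  assumes "m \<noteq> n"
  shows "\<not> isomorphic_submodules \<rho> (V m) (V n)"
proof
  assume "isomorphic_submodules \<rho> (V m) (V n)"
  then obtain \<phi> where bij: "bij_betw \<phi> (V m) (V n)"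
    and scale_all: "\<forall>c. \<forall>f\<in>V m. \<phi> (smult c f) = smult c (\<phi> f)"
    and equiv_all: "\<forall>a. \<forall>f\<in>V m. \<phi> (\<rho> a f) = \<rho> a (\<phi> f)"
    unfolding isomorphic_submodules_def by (elim exE conjE)
  note scale = scale_all[rule_format] and equiv = equiv_all[rule_format]
  let ?p = "pw (2 * m)"
  have p: "?p \<in> V m" using wilson_poly_mem[of "2 * m"] by simp
  have z: "0 \<in> V m" by (rule cpoly.subspace_0[OF subspace_V])
  have "\<phi> 0 = 0" using scale[OF z, of 0] by simp
  then have nz: "\<phi> ?p \<noteq> 0"
    using bij p z wilson_poly_neq_0[of "2 * m"] by (metis bij_betw_def inj_onD)
  have "\<phi> ?p \<in> V n" using bij p by (rule bij_betwE[rule_format])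
  \<comment> \<open>An isomorphism would carry the scalar by which \<open>\<xi> * \<xi>\<close> acts
    on \<open>V m\<close> over to \<open>V n\<close>, where that scalar is different.\<close>
  then have "smult ((\<gamma> (2 * n))\<^sup>2) (\<phi> ?p) = \<rho> (\<xi> * \<xi>) (\<phi> ?p)"
    by (simp add: V_iff_eigenvector rep_simps rep_xi)
  also have "\<dots> = \<phi> (\<rho> (\<xi> * \<xi>) ?p)" using equiv[OF p] by simp
  also have "\<dots> = smult ((\<gamma> (2 * m))\<^sup>2) (\<phi> ?p)"
    using V_imp_eigenvector[OF p] by (simp add: rep_simps rep_xi scale[OF p])
  finally have "(\<gamma> (2 * n))\<^sup>2 = (\<gamma> (2 * m))\<^sup>2" using nz by (simp add: smult_eq_iff)
  then show False using inj_gamma_square assms by (auto dest: injD)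
qed

lemma even_poly_uminus: "q \<in> even_polys \<Longrightarrow> poly q (- x) = poly q x"
  by (auto simp: even_polys_def poly_pcompose poly_monom)

text \<open>An even polynomial agrees at \<open>\<gamma> (2 * n)\<close> and its negative, so both
  generators of \<open>V n\<close> get the same scalar.\<close>

lemma rep_even_poly:
  assumes "q \<in> even_polys" "f \<in> V n"
  shows "\<rho> (walg_eval q \<xi>) f = smult (poly q (\<gamma> (2 * n))) f"
proof -
  have "V n \<subseteq> {f. \<rho> (walg_eval q \<xi>) f = smult (poly q (\<gamma> (2 * n))) f}"
  proof (rule V_subsetI)
    show "cpoly.subspace {f. \<rho> (walg_eval q \<xi>) f = smult (poly q (\<gamma> (2 * n))) f}"
      using rep_simps(6)[of _ 0 0]
      by (auto simp: cpoly.subspace_def rep_simps smult_add_right mult.commute)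
  qed (use rep_walg_eval[OF wilson_poly_properties(3)] assms(1) in \<open>auto simp: gamma_odd even_poly_uminus\<close>)
  then show ?thesis using assms(2) by auto
qed

end

theorem theorem2p8:
  fixes t0 u0 t1 u1 :: complex
  assumes "t0 \<noteq> 0" and "t1 \<noteq> 0"
    and "\<forall>n::nat. n \<ge> 1 \<longrightarrow> t0 + t1 \<noteq> - (of_nat n / 2)"
  shows "faithful_rep (pi_rep t0 u0 t1 u1) \<and>
    (2 * t0 \<notin> \<int> \<and> 2 * t1 \<notin> \<int> \<longrightarrow>
      mult_free_irred_decomposition (pi_rep t0 u0 t1 u1) (wilson_space t0 u0 t1 u1) \<and>
      (\<forall>p\<in>even_polys.
        walg_eval p (xi t0 t1) \<in> walg_center \<and>
        (\<forall>n. \<forall>f\<in>wilson_space t0 u0 t1 u1 n.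
          pi_rep t0 u0 t1 u1 (walg_eval p (xi t0 t1)) f =
            smult (poly p (wilson_gamma t0 t1 (2 * n))) f)))"
proof -
  interpret generic_wilson t0 u0 t1 u1 using assms by unfold_locales auto
  show ?thesis
    using assms(1,2) rep_faithful V_decomposition irreducible_V V_not_isomorphic
    by (auto simp: mult_free_irred_decomposition_def walg_eval_even_center rep_even_poly)
qed

end
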